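(* Let $m=2n$ with $n\ge1$ an integer, and let $K_4^m$ be the radially deformed Fourier kernel on $\mathbb{R}^m$ with parameter $a=4$ (see context). With $z=|x||y|$ and $\langle x,y\rangle=z\cos\theta$, $$K_4^m(x,y)=c_n\,e^{\frac{i}{2}z^2\sin^2\theta}\,D_{-n}\big[(i-1)z\cos\theta\big],\qquad c_n=\frac{2^{n/2}\,\Gamma\left(\frac{n+1}{2}\right)}{\sqrt{\pi}},$$ where $D_\nu$ is the parabolic cylinder function. Furthermore, there exists a constant $C>0$ such that $$\left|K_4^m(x,y)\right|\le C\left(1+|x||y|\right)^{\frac{m-2}{2}}\qquad\text{for all }x,y\in\mathbb{R}^m,$$ and the growth order $(m-2)/2$ is optimal (i.e. the exponent $(m-2)/2$ cannot be replaced by a smaller one in a bound of this form).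
   Context: For an integer $m\ge2$ put $\lambda=(m-2)/2$. Let $a>0$. For $x,y\in\mathbb{R}^m\setminus\{0\}$ put $z=|x||y|$, $\xi=\langle x,y\rangle/z=\cos\theta$ with $\theta\in[0,\pi]$. For $m\ge3$ the radially deformed Fourier kernel is $$K_a^m(x,y)=K_a^m(z,\xi)=a^{2\lambda/a}\,\Gamma\left(\frac{2\lambda+a}{a}\right)\sum_{k=0}^{\infty}e^{-\frac{i\pi k}{a}}\frac{\lambda+k}{\lambda}z^{-\lambda}J_{\frac{2(k+\lambda)}{a}}\left(\frac{2}{a}z^{a/2}\right)C_k^{(\lambda)}(\xi),$$ and for $m=2$ it is the limit $\lambda\to0$ of this expression, namely $$K_a^2(x,y)=K_a^2(z,\xi)=J_0(z_a)+2\sum_{k=1}^{\infty}e^{-\frac{i\pi k}{a}}J_{\frac{2k}{a}}(z_a)\cos k\theta,\qquad z_a=\frac2a z^{a/2}.$$ Here $J_\nu$ is the Bessel function of the first kind and $C_k^{(\lambda)}$ is the Gegenbauer polynomial. If $x=0$ or $y=0$ the kernel is defined by continuity and equals $1$. The parabolic cylinder function (Whittaker's notation, $D_{-\nu-1/2}(w)=U(\nu,w)$) is entire in $w$ and, for integers $n\ge1$, is given by $D_{-n}(w)=\frac{e^{-w^2/4}}{\Gamma(n)}\int_0^\infty t^{n-1}e^{-t^2/2-wt}\,dt$. *)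

theory Defs
  imports "HOL-Analysis.Analysis"
begin

text \<open>
  Bessel function of the first kind of real order, by its power series. The factor
  \<open>(x/2) powr \<nu>\<close> makes this meaningful for \<open>x > 0\<close> only (note that \<open>0 powr 0 = 0\<close>);
  the kernel below evaluates it only there. \<open>rGamma\<close> is the reciprocal Gamma function.
\<close>

definition bessel_J :: "real \<Rightarrow> real \<Rightarrow> real" where
  "bessel_J \<nu> x = (x / 2) powr \<nu> *
     (\<Sum>j. (- 1) ^ j / fact j * rGamma (\<nu> + real j + 1) * (x / 2) ^ (2 * j))"

definition gegenbauer :: "nat \<Rightarrow> real \<Rightarrow> real \<Rightarrow> real" where
  "gegenbauer k lam \<xi> =
     (\<Sum>j\<le>k div 2. (- 1) ^ j * pochhammer lam (k - j) / (fact j * fact (k - 2 * j))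
        * (2 * \<xi>) ^ (k - 2 * j))"

text \<open>
  \<open>radial_kernel m a z \<xi>\<close> is the series for the kernel in dimension \<open>m \<ge> 2\<close>, for \<open>z > 0\<close> and
  \<open>\<xi> \<in> {-1..1}\<close>. The case \<open>m = 2\<close> is the limit of the general expansion as \<open>lam = (m-2)/2\<close> tends to 0;
  there the index is shifted (\<open>k = j + 1\<close>) so that the sum starts at \<open>k = 1\<close>.
\<close>

definition radial_kernel :: "nat \<Rightarrow> real \<Rightarrow> real \<Rightarrow> real \<Rightarrow> complex" where
  "radial_kernel m a z \<xi> =
    (let z\<^sub>a = 2 / a * z powr (a / 2); lam = (real m - 2) / 2 in
     if m = 2 then
       of_real (bessel_J 0 z\<^sub>a) +
       2 * (\<Sum>j. let k = Suc j in
              exp (- \<i> * of_real (pi * real k / a)) *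
              of_real (bessel_J (2 * real k / a) z\<^sub>a * cos (real k * arccos \<xi>)))
     else
       of_real (a powr (2 * lam / a) * Gamma ((2 * lam + a) / a)) *
       (\<Sum>k. exp (- \<i> * of_real (pi * real k / a)) *
          of_real ((lam + real k) / lam * z powr (- lam) *
            bessel_J (2 * (real k + lam) / a) z\<^sub>a * gegenbauer k lam \<xi>)))"

definition deformed_kernel :: "real \<Rightarrow> real ^ 'm \<Rightarrow> real ^ 'm \<Rightarrow> complex" where
  "deformed_kernel a x y =
    (if x = 0 \<or> y = 0 then 1
     else radial_kernel CARD('m) a (norm x * norm y) ((x \<bullet> y) / (norm x * norm y)))"

text \<open>
  \<open>parabolic_D_neg n w\<close> is the parabolic cylinder function \<open>D\<^sub>\<nu>(w)\<close> in Whittaker's notation at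
  the order \<open>\<nu> = -n\<close>, for an integer \<open>n \<ge> 1\<close>.
\<close>

definition parabolic_D_neg :: "nat \<Rightarrow> complex \<Rightarrow> complex" where
  "parabolic_D_neg n w = exp (- (w\<^sup>2) / 4) / Gamma (of_nat n) *
     (LINT t:{0..}|lborel.
        of_real (t ^ (n - 1)) * exp (- (of_real t)\<^sup>2 / 2 - w * of_real t))"

end

theory Submission
  imports Defs "HOL-Probability.Distributions" "HOL-Real_Asymp.Real_Asymp"
begin

text \<open>
  Write \<open>m = 2 * n\<close>, \<open>lam = n - 1\<close>, \<open>z\<close> for the product of the two norms and \<open>\<xi> = cos \<theta>\<close>. For
  \<open>a = 4\<close> the Bessel argument is \<open>z\<^sup>2 / 2\<close> and the orders are \<open>(k + lam) / 2\<close>, so that, with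
  \<open>s = exp (- \<i> * pi / 4) * z / 2\<close>, the Bessel sign \<open>(- 1) ^ j\<close> is absorbed in \<open>s ^ (4 * j)\<close> and
  the kernel is \<open>Gamma ((n + 1) / 2)\<close> times the power series
  \<open>\<Sum>k j. s ^ (k + 4 * j) / (fact j * Gamma ((k + lam) / 2 + j + 1)) * P k \<xi>\<close>, where
  \<open>P k \<xi> = (lam + k) / lam * gegenbauer k lam \<xi>\<close>, or its limit if \<open>lam = 0\<close>.
  Expanding the Gegenbauer polynomials, with index \<open>i\<close> for the power \<open>l = k - 2 * i\<close> of \<open>2 * \<xi>\<close>,
  gives a triple series. Collected by \<open>l\<close> and \<open>p = i + 2 * j\<close> instead, its inner sums are finite
  and have a closed form, \<open>gegen_weight_sum\<close>. What remains is the product of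
  \<open>exp (- 2 * s\<^sup>2) = exp (\<i> * z\<^sup>2 / 2)\<close> and a power series in \<open>\<xi> * s\<close>, the exponential
  generating function of the moments of the Gaussian on the half-line from order \<open>lam\<close> on.
  That series is the integral in the parabolic cylinder function
  (\<open>set_integral_half_laplace\<close>), which gives the formula. The terms of each finite inner sum have
  the same phase, so the rearrangement is absolutely convergent as soon as the product is.

  For the growth, the formula reduces the modulus of the kernel to that of
  \<open>half_laplace lam \<beta>\<close>, the integral of \<open>t ^ lam * exp (- t\<^sup>2 / 2 + \<beta> * t)\<close> over the half-line, on the ray
  \<open>\<beta> = (1 - \<i>) * u\<close> with \<open>u\<close> the inner product of the two vectors. There \<open>\<beta>\<^sup>2\<close> is purely imaginary. For
  \<open>lam = 0\<close> the values at \<open>\<beta>\<close> and \<open>- \<beta>\<close> add up to the full Gaussian integral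
  \<open>sqrt (2 * pi) * exp (\<beta>\<^sup>2 / 2)\<close>, of constant modulus, while the integral itself is small when \<open>Re \<beta>\<close>
  is very negative; hence it is bounded and tends to \<open>sqrt (2 * pi)\<close> in modulus as \<open>u\<close> grows. The three-term
  recurrence \<open>half_laplace_rec\<close> adds one power of \<open>\<beta>\<close> in each step, so the order of growth is exactly
  \<open>lam = (m - 2) / 2\<close>.
\<close>

section \<open>The inner sum of the rearranged series\<close>

text \<open>
  For \<open>h > 0\<close> this is \<open>(2 * h + 2 * i) * Gamma (2 * h + i) / (Gamma (2 * h + 1) * fact i)\<close>. With
  \<open>h = (lam + l) / 2\<close> it is, up to a factor depending only on \<open>lam\<close> and \<open>l\<close>, the modulus of the
  coefficient of \<open>(2 * \<xi>) ^ l\<close> in \<open>(lam + k) / lam\<close> times the Gegenbauer polynomial of degree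
  \<open>k = l + 2 * i\<close>. Split into two summands it also makes sense for \<open>h = 0\<close>, where it is \<open>1\<close> for \<open>i = 0\<close>
  and \<open>2\<close> otherwise, as the Chebyshev case \<open>lam = 0\<close> requires.
\<close>

definition gegen_weight :: "real \<Rightarrow> nat \<Rightarrow> real" where
  "gegen_weight h i = pochhammer (2 * h + 1) i / fact i +
     (if i = 0 then 0 else pochhammer (2 * h + 1) (i - 1) / fact (i - 1))"

text \<open>
  A Wilf-Zeilberger certificate for \<open>gegen_weight_sum\<close>: the sums \<open>S p = (\<Sum>j. T p j)\<close> are to satisfy
  \<open>(p + 1) * S (p + 1) = 2 * S p\<close>, and the differences of the summands telescope with the right-hand side
  as partial sum. Analytically it is the recurrence
  \<open>\<nu> * I \<nu> x = x / 2 * (I (\<nu> - 1) x - I (\<nu> + 1) x)\<close> of the modified Bessel functions, which shows that the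
  series with coefficients \<open>S p\<close> has twice itself as derivative. The factor \<open>real J / fact J\<close> stands for
  \<open>1 / fact (J - 1)\<close>, read as \<open>0\<close> at \<open>J = 0\<close>.
\<close>

lemma gegen_weight_telescope:
  fixes h :: real
  assumes h: "h \<ge> 0"
  defines "T \<equiv> \<lambda>p j. gegen_weight h (p - 2 * j) / (fact j * pochhammer (h + 1) (p - j))"
  assumes J: "2 * J \<le> p + 1"
  shows "(\<Sum>j<J. (real p + 1) * T (Suc p) j - 2 * T p j) =
    - 2 * pochhammer (2 * h + 1) (p + 1 - 2 * J) / fact (p + 1 - 2 * J) * (real J / fact J)
      / pochhammer (h + 1) (p + 1 - J)"
  using J
proof (induction J)
  case 0
  then show ?case by simp
next
  case (Suc J)
  \<comment> \<open>The \<open>J\<close>-th summands of rows \<open>p\<close> and \<open>p + 1\<close> carry the weights of index \<open>i + 1\<close> and \<open>i + 2\<close>.\<close>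
  define i where "i = p - 1 - 2 * J"
  have p: "p = i + 1 + 2 * J" using Suc.prems by (simp add: i_def)
  define u where "u = (\<lambda>i. pochhammer (2 * h + 1) i / fact i)"
  define Q where "Q = pochhammer (h + 1) (i + 1 + J)"
  have Q0: "Q > 0" unfolding Q_def using h by (intro pochhammer_pos) auto
  have f0: "(fact J :: real) > 0" by simp
  have rec: "u (Suc k) * (real k + 1) = u k * (2 * h + 1 + real k)" for k
  proof -
    have *: "P * c / (r * f) * r = P / f * c" if "r \<noteq> 0" for P c r f :: real
      using that by simp
    have "(fact (Suc k) :: real) = (real k + 1) * fact k" by simp
    then show ?thesis unfolding u_def pochhammer_Suc by (simp only: * of_nat_eq_0_iff)
  qed
  have W: "gegen_weight h (Suc k) = u (Suc k) + u k" for k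
    by (simp add: gegen_weight_def u_def)
  have Q2: "pochhammer (h + 1) (i + 2 + J) = Q * (h + 2 + real i + real J)"
    unfolding Q_def by (simp add: pochhammer_Suc algebra_simps)
  have c: "h + 2 + real i + real J > 0" using h by simp
  have T1: "T (Suc p) J = (u (i + 2) + u (i + 1)) / (fact J * (Q * (h + 2 + real i + real J)))"
    using W[of "Suc i"] unfolding T_def p Q2[symmetric]
    by (simp add: eval_nat_numeral)
  have T2: "T p J = (u (i + 1) + u i) / (fact J * Q)"
    using W[of "i"] unfolding T_def p Q_def
    by (simp add: eval_nat_numeral)
  have IH: "(\<Sum>j<J. (real p + 1) * T (Suc p) j - 2 * T p j) =
     - 2 * u (i + 2) * (real J / fact J) / (Q * (h + 2 + real i + real J))"
    using Suc unfolding Q2[symmetric] u_def p by (simp add: eval_nat_numeral)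
  have G: "- 2 * pochhammer (2 * h + 1) (p + 1 - 2 * Suc J) / fact (p + 1 - 2 * Suc J) *
         (real (Suc J) / fact (Suc J)) / pochhammer (h + 1) (p + 1 - Suc J)
       = - 2 * u i / (fact J * Q)"
    unfolding u_def p Q_def by (simp add: field_simps del: of_nat_Suc)
  \<comment> \<open>Without the denominators, the induction step says no more than this recurrence of \<open>u\<close>.\<close>
  have "u (i + 2) * (real i + 2) = u (i + 1) * (2 * h + 2 + real i)"
    using rec[of "i + 1"] by (simp add: algebra_simps)
  then have key: "(real p + 1) * (u (i + 2) + u (i + 1)) - 2 * (u (i + 1) + u i) * (h + 2 + real i + real J)
      - 2 * u (i + 2) * real J = - 2 * u i * (h + 2 + real i + real J)"
    unfolding p of_nat_add of_nat_mult of_nat_numeral of_nat_1 by algebra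
  have gen: "- 2 * b * (j / f) / (q * c) + (r * ((b + a) / (f * (q * c))) - 2 * ((a + e) / (f * q)))
      = - 2 * e / (f * q)"
    if "r * (b + a) - 2 * (a + e) * c - 2 * b * j = - 2 * e * c" "f > 0" "q > 0" "c > 0"
    for a b c e f q r j :: real
    using that by (simp add: field_simps)
  show ?case
    unfolding sum.lessThan_Suc IH T1 T2 G
    by (rule gen[OF key f0 Q0 c])
qed

text \<open>
  The Taylor coefficients in Gegenbauer's expansion of \<open>exp (2 * x)\<close> in modified Bessel functions. The sum
  runs over the pairs \<open>(i, j)\<close> with \<open>i + 2 * j = p\<close>. At the upper end the telescoped sum misses one
  summand of row \<open>p + 1\<close> and, for even \<open>p\<close>, one of row \<open>p\<close>; they cancel what the telescoping leaves.
\<close>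

lemma gegen_weight_sum:
  fixes h :: real
  assumes h: "h \<ge> 0"
  shows "(\<Sum>j\<le>p div 2. gegen_weight h (p - 2 * j) / (fact j * pochhammer (h + 1) (p - j))) = 2 ^ p / fact p"
proof (induction p)
  case 0
  show ?case by (simp add: gegen_weight_def)
next
  case (Suc p)
  define T where "T \<equiv> \<lambda>p j. gegen_weight h (p - 2 * j) / (fact j * pochhammer (h + 1) (p - j))"
  have tel: "(\<Sum>j<J. (real p + 1) * T (Suc p) j - 2 * T p j) =
    - 2 * pochhammer (2 * h + 1) (p + 1 - 2 * J) / fact (p + 1 - 2 * J) * (real J / fact J)
      / pochhammer (h + 1) (p + 1 - J)" if "2 * J \<le> p + 1" for J
    unfolding T_def by (rule gegen_weight_telescope[OF h that])
  have "(real p + 1) * (\<Sum>j\<le>Suc p div 2. T (Suc p) j) = 2 * (\<Sum>j\<le>p div 2. T p j)"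
  proof (cases "even p")
    case True
    then obtain e where e: "p = 2 * e" by (elim evenE)
    have c: "h + 1 + real e > 0" using h by simp
    have Q0: "pochhammer (h + 1) e > 0" using h by (intro pochhammer_pos) auto
    define X where "X = 2 * (2 * h + 1) * (real e / fact e) / pochhammer (h + 1) (e + 1)"
    have "(real p + 1) * (\<Sum>j<e. T (Suc p) j) - 2 * (\<Sum>j<e. T p j) = - X"
      using tel[of e] unfolding sum_subtractf sum_distrib_left[symmetric]
      by (simp add: e X_def minus_divide_left[symmetric] algebra_simps diff_divide_distrib add_divide_distrib)
    moreover have "(real p + 1) * T (Suc p) e - 2 * T p e = X"
      using c Q0 unfolding X_def T_def e gegen_weight_def
      by (simp add: pochhammer_Suc divide_simps) (simp add: algebra_simps)
    ultimately show ?thesis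
      by (simp add: e lessThan_Suc_atMost[symmetric] algebra_simps)
  next
    case False
    then obtain e where e: "p = 2 * e + 1" by (elim oddE)
    have Q0: "pochhammer (h + 1) (e + 1) > 0" using h by (intro pochhammer_pos) auto
    have "(real p + 1) * (\<Sum>j<Suc e. T (Suc p) j) - 2 * (\<Sum>j<Suc e. T p j) =
       - 2 * (real (Suc e) / fact (Suc e)) / pochhammer (h + 1) (e + 1)"
      using tel[of "Suc e"] unfolding sum_subtractf sum_distrib_left[symmetric] by (simp add: e)
    moreover have "(real p + 1) * T (Suc p) (Suc e) =
       2 * (real (Suc e) / fact (Suc e)) / pochhammer (h + 1) (e + 1)"
      using Q0 unfolding T_def e gegen_weight_def
      by (simp add: divide_simps)
    moreover have "Suc p div 2 = Suc e" "p div 2 = e" by (auto simp: e)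
    ultimately show ?thesis
      by (simp add: lessThan_Suc_atMost[symmetric] algebra_simps del: of_nat_Suc fact_Suc)
  qed
  with Suc have "(real p + 1) * (\<Sum>j\<le>Suc p div 2. T (Suc p) j) = 2 * (2 ^ p / fact p)"
    unfolding T_def by simp
  moreover have "S = 2 * q / (a * f)" if "a * S = 2 * (q / f)" "a > 0" "f > 0" for a S q f :: real
    using that by (simp add: field_simps)
  ultimately have "(\<Sum>j\<le>Suc p div 2. T (Suc p) j) = 2 * 2 ^ p / ((real p + 1) * fact p)"
    by simp
  then show ?case unfolding T_def by (simp add: add.commute)
qed

lemma gegen_weight_sum_rGamma:
  fixes h :: real
  assumes h: "h \<ge> 0"
  shows "(\<Sum>j\<le>p div 2. gegen_weight h (p - 2 * j) * rGamma (h + 1 + real (p - j)) / fact j)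
     = 2 ^ p / fact p * rGamma (h + 1)"
proof -
  have "gegen_weight h (p - 2 * j) * rGamma (h + 1 + real (p - j)) / fact j
     = gegen_weight h (p - 2 * j) / (fact j * pochhammer (h + 1) (p - j)) * rGamma (h + 1)" for j
  proof -
    have "pochhammer (h + 1) (p - j) > 0" using h by (intro pochhammer_pos) auto
    then show ?thesis
      using pochhammer_rGamma[of "h + 1" "p - j"] by simp
  qed
  then show ?thesis
    unfolding gegen_weight_sum[OF h, symmetric] sum_distrib_right by (intro sum.cong refl)
qed

lemma gegen_weight_pos: "h \<ge> 0 \<Longrightarrow> gegen_weight h i > 0"
  unfolding gegen_weight_def
  using pochhammer_pos[of "2 * h + 1"]
  by (cases i) (auto intro!: add_pos_pos divide_pos_pos)

section \<open>Gaussian integrals over the half-line\<close>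

text \<open>
  The moments of \<open>exp (- t\<^sup>2 / 2)\<close> over the half-line, by the recursion that integration by parts gives.
  The same recursion yields the recurrences of the Laplace transform below.
\<close>

fun half_moment :: "nat \<Rightarrow> real" where
  "half_moment 0 = sqrt (pi / 2)"
| "half_moment (Suc 0) = 1"
| "half_moment (Suc (Suc k)) = (real k + 1) * half_moment k"

lemma half_moment_nonneg: "half_moment k \<ge> 0"
  by (induction k rule: half_moment.induct) auto

lemma half_moment_even: "half_moment (2 * j) = sqrt (pi / 2) * fact (2 * j) / (2 ^ j * fact j)"
proof (induction j)
  case (Suc j)
  have "half_moment (2 * Suc j) = (2 * real j + 1) * half_moment (2 * j)" by simp
  also have "\<dots> = (2 * real j + 1) * (sqrt (pi / 2) * fact (2 * j) / (2 ^ j * fact j)) *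
      ((2 * real j + 2) / (2 * (real j + 1)))"
    by (simp add: Suc add_eq_0_iff)
  also have "\<dots> = sqrt (pi / 2) * fact (2 * Suc j) / (2 ^ Suc j * fact (Suc j))"
    by (simp add: divide_simps add_eq_0_iff)
  finally show ?case .
qed simp

lemma half_moment_odd: "half_moment (2 * j + 1) = 2 ^ j * fact j"
  by (induction j) (simp_all add: field_simps)

text \<open>
  In this form, where Legendre's duplication formula is built in, the moments appear as coefficients of the
  rearranged kernel series.
\<close>

lemma half_moment_eq_rGamma:
  "half_moment k * 2 powr ((real k + 1) / 2) / sqrt pi = fact k * rGamma (real k / 2 + 1)"
proof (induction k rule: half_moment.induct)
  case 1
  then show ?case by (simp add: real_sqrt_divide powr_half_sqrt)
next
  case 2
  have "rGamma (1 / 2 + 1 :: real) * (1 / 2) = rGamma (1 / 2)"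
    using rGamma_plus1[of "1 / 2 :: real"] by simp
  moreover have "rGamma (1 / 2 :: real) = 1 / sqrt pi"
    by (simp add: rGamma_inverse_Gamma Gamma_one_half_real field_simps)
  ultimately show ?case by (simp add: field_simps)
next
  case (3 k)
  have "rGamma (real k / 2 + 1) = (real k / 2 + 1) * rGamma (real k / 2 + 1 + 1)"
    using rGamma_plus1[of "real k / 2 + 1"] by simp
  moreover have "2 powr ((real (Suc (Suc k)) + 1) / 2) = 2 * 2 powr ((real k + 1) / 2)"
    by (simp add: powr_add[symmetric] powr_mult_base add_divide_distrib)
  ultimately show ?case using 3
    by (simp add: field_simps)
qed

text \<open>
  Substitute \<open>t / sqrt 2\<close> in the moments of \<open>exp (- x\<^sup>2)\<close>.
\<close>

lemma has_bochner_integral_half_moment: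
  "has_bochner_integral lborel (\<lambda>t. indicator {0..} t *\<^sub>R (t ^ k * exp (- t\<^sup>2 / 2))) (half_moment k)"
proof -
  define I where "I = half_moment k / sqrt 2 ^ Suc k"
  have "has_bochner_integral lborel (\<lambda>x::real. indicator {0..} x *\<^sub>R (exp (- x\<^sup>2) * x ^ k)) I"
  proof (cases "even k")
    case True
    then obtain j where j: "k = 2 * j" by (elim evenE)
    have "I = (sqrt pi / 2) * (fact (2 * j) / (2 ^ (2 * j) * fact j))"
      using power_mult[of "sqrt 2" 2 j] power_mult[of "2::real" j 2]
      unfolding I_def j half_moment_even
      by (simp add: real_sqrt_divide field_simps power2_eq_square)
    then show ?thesis using gaussian_moment_even_pos[of j] by (simp add: j)
  next
    case False
    then obtain j where j: "k = 2 * j + 1" by (elim oddE)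
    have "I = fact j / 2"
    proof -
      have "sqrt 2 ^ Suc k = sqrt 2 ^ (2 * Suc j)" by (simp add: j)
      also have "\<dots> = (2::real) * 2 ^ j" unfolding power_mult by simp
      finally show ?thesis unfolding I_def j half_moment_odd by simp
    qed
    then show ?thesis using gaussian_moment_odd_pos[of j] by (simp only: j)
  qed
  then have "has_bochner_integral lborel
      (\<lambda>x. indicator {0..} (0 + (1 / sqrt 2) * x) *\<^sub>R (exp (- (0 + (1 / sqrt 2) * x)\<^sup>2) * (0 + (1 / sqrt 2) * x) ^ k)) (I /\<^sub>R \<bar>1 / sqrt 2\<bar>)"
    by (subst (asm) lborel_has_bochner_integral_real_affine_iff[where c = "1 / sqrt 2" and t = 0]) auto
  then have "has_bochner_integral lborel
      (\<lambda>x. sqrt 2 ^ k * (indicator {0..} (0 + (1 / sqrt 2) * x) *\<^sub>R (exp (- (0 + (1 / sqrt 2) * x)\<^sup>2) * (0 + (1 / sqrt 2) * x) ^ k))) (sqrt 2 ^ k * (I /\<^sub>R \<bar>1 / sqrt 2\<bar>))"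
    by (rule has_bochner_integral_mult_right)
  also have "sqrt 2 ^ k * (I /\<^sub>R \<bar>1 / sqrt 2\<bar>) = half_moment k"
    by (simp add: I_def field_simps)
  also have "(\<lambda>x. sqrt 2 ^ k * (indicator {0..} (0 + (1 / sqrt 2) * x) *\<^sub>R (exp (- (0 + (1 / sqrt 2) * x)\<^sup>2) * (0 + (1 / sqrt 2) * x) ^ k)))
     = (\<lambda>t. indicator {0..} t *\<^sub>R (t ^ k * exp (- t\<^sup>2 / 2)))"
    by (rule ext) (auto simp: indicator_def power_divide zero_le_divide_iff)
  finally show ?thesis .
qed

lemma has_bochner_integral_power_exp:
  "has_bochner_integral lborel (\<lambda>t. indicator {0..} t *\<^sub>R (t ^ k * exp (- t) :: real)) (fact k)"
proof (rule has_bochner_integral_nn_integral)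
  have "(\<integral>\<^sup>+t. ennreal (indicator {0..} t *\<^sub>R (t ^ k * exp (- t))) \<partial>lborel) =
      (\<integral>\<^sup>+t. ennreal (t ^ k * exp (- t)) * indicator {0..} t \<partial>lborel)"
    by (intro nn_integral_cong) (auto simp: indicator_def)
  then show "(\<integral>\<^sup>+t. ennreal (indicator {0..} t *\<^sub>R (t ^ k * exp (- t))) \<partial>lborel) = ennreal (fact k)"
    by (simp add: nn_intergal_power_times_exp_Ici)
qed (auto simp: indicator_def)

text \<open>
  Each partial sum is at most the integral of \<open>t ^ k * exp (b * t - t\<^sup>2 / 2)\<close>. Completing the square,
  \<open>b * t - t\<^sup>2 / 2 \<le> (b + 1)\<^sup>2 / 2 - t\<close>, bounds the partial sums uniformly.
\<close>

lemma summable_exp_half_moment: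
  fixes b :: real
  assumes "b \<ge> 0"
  shows "summable (\<lambda>l. b ^ l / fact l * half_moment (k + l))"
proof (rule summableI_nonneg_bounded)
  let ?f = "\<lambda>t::real. indicator {0..} t *\<^sub>R (t ^ k * exp (- t))"
  let ?C = "exp ((b + 1)\<^sup>2 / 2)"
  fix L
  show "(\<Sum>l<L. b ^ l / fact l * half_moment (k + l)) \<le> ?C * fact k"
  proof -
    have "has_bochner_integral lborel (\<lambda>t. \<Sum>l<L. b ^ l / fact l * (indicator {0..} t *\<^sub>R (t ^ (k + l) * exp (- t\<^sup>2 / 2))))
       (\<Sum>l<L. b ^ l / fact l * half_moment (k + l))"
      by (intro has_bochner_integral_sum has_bochner_integral_mult_right has_bochner_integral_half_moment)
    moreover have "has_bochner_integral lborel (\<lambda>t. ?C * ?f t) (?C * fact k)"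
      by (intro has_bochner_integral_mult_right has_bochner_integral_power_exp)
    moreover have "(\<Sum>l<L. b ^ l / fact l * (indicator {0..} t *\<^sub>R (t ^ (k + l) * exp (- t\<^sup>2 / 2)))) \<le> ?C * ?f t" for t
    proof (cases "t \<ge> 0")
      case True
      have "(\<Sum>l<L. (b * t) ^ l / fact l) \<le> exp (b * t)"
        using True assms sum_le_suminf[OF summable_exp_generic[of "b * t"], of "{..<L}"]
        by (simp add: exp_def divide_inverse mult_ac scaleR_conv_of_real)
      then have "t ^ k * exp (- t\<^sup>2 / 2) * (\<Sum>l<L. (b * t) ^ l / fact l) \<le> t ^ k * exp (- t\<^sup>2 / 2) * exp (b * t)"
        using True by (intro mult_left_mono) auto
      also have "\<dots> \<le> t ^ k * (?C * exp (- t))"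
      proof -
        have "0 \<le> ((b + 1) - t)\<^sup>2" by simp
        then have "- t\<^sup>2 / 2 + b * t \<le> (b + 1)\<^sup>2 / 2 - t"
          by (simp add: power2_eq_square field_simps)
        then have "exp (- t\<^sup>2 / 2) * exp (b * t) \<le> ?C * exp (- t)"
          by (simp add: exp_add[symmetric])
        then show ?thesis using True by (simp add: mult.assoc mult_left_mono)
      qed
      finally show ?thesis using True
        by (simp add: sum_distrib_left power_add power_mult_distrib mult_ac)
    qed simp
    ultimately show ?thesis
      unfolding has_bochner_integral_iff using integral_mono by (metis (no_types, lifting))
  qed
qed (use assms half_moment_nonneg in auto)

text \<open>
  The Laplace transform \<open>\<beta> \<mapsto> \<integral>t. t ^ k * exp (- t\<^sup>2 / 2 + \<beta> * t)\<close> over the half-line, taken as a power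
  series because this is the form in which it comes out of the kernel; \<open>set_integral_half_laplace\<close>
  identifies it with the integral.
\<close>

definition half_laplace :: "nat \<Rightarrow> complex \<Rightarrow> complex" where
  "half_laplace k \<beta> = (\<Sum>l. \<beta> ^ l / fact l * of_real (half_moment (k + l)))"

lemma summable_norm_half_laplace:
  "summable (\<lambda>l. norm (\<beta> ^ l / fact l * complex_of_real (half_moment (k + l))))"
  using summable_exp_half_moment[of "norm \<beta>" k]
  by (simp add: norm_mult norm_divide norm_power half_moment_nonneg)

lemma half_laplace_sums:
  "(\<lambda>l. \<beta> ^ l / fact l * of_real (half_moment (k + l))) sums half_laplace k \<beta>"
  unfolding half_laplace_def by (rule summable_sums[OF summable_norm_cancel[OF summable_norm_half_laplace]])

lemma set_integral_half_laplace:
  fixes \<beta> :: complex and k :: nat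
  defines "f \<equiv> \<lambda>t. indicator {0..} t *\<^sub>R (of_real (t ^ k) * exp (- (of_real t)\<^sup>2 / 2 + \<beta> * of_real t))"
  shows "integrable lborel f" and "(\<integral>t. f t \<partial>lborel) = half_laplace k \<beta>"
proof -
  define F where "F = (\<lambda>l t. (\<beta> ^ l / fact l) * complex_of_real (indicator {0..} t *\<^sub>R (t ^ (k + l) * exp (- t\<^sup>2 / 2))))"
  have B: "has_bochner_integral lborel (F l) (\<beta> ^ l / fact l * of_real (half_moment (k + l)))" for l
    unfolding F_def
    by (intro has_bochner_integral_mult_right has_bochner_integral_of_real has_bochner_integral_half_moment)
  have nF: "norm (F l t) = norm \<beta> ^ l / fact l * (indicator {0..} t *\<^sub>R (t ^ (k + l) * exp (- t\<^sup>2 / 2)))" for l t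
    by (simp add: F_def norm_mult norm_divide norm_power indicator_def)
  have N: "(\<integral>t. norm (F l t) \<partial>lborel) = norm \<beta> ^ l / fact l * half_moment (k + l)" for l
    unfolding nF
    by (intro has_bochner_integral_integral_eq has_bochner_integral_mult_right has_bochner_integral_half_moment)
  have Feq: "F l t = (indicator {0..} t *\<^sub>R (of_real (t ^ k) * exp (- (of_real t)\<^sup>2 / 2))) *
      ((\<beta> * of_real t) ^ l /\<^sub>R fact l)" for l t
  proof -
    have "exp (- (complex_of_real t)\<^sup>2 / 2) = of_real (exp (- t\<^sup>2 / 2))"
      using exp_of_real[of "- t\<^sup>2 / 2", where 'a = complex] by simp
    then show ?thesis
      by (simp add: F_def power_add power_mult_distrib scaleR_conv_of_real field_simps)
  qed
  have fS: "(\<lambda>l. F l t) sums f t" for t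
  proof -
    have "(\<lambda>l. F l t) sums ((indicator {0..} t *\<^sub>R (of_real (t ^ k) * exp (- (of_real t)\<^sup>2 / 2))) * exp (\<beta> * of_real t))"
      unfolding Feq by (intro sums_mult exp_converges)
    then show ?thesis by (simp add: f_def exp_add[symmetric] mult.assoc)
  qed
  have sum: "summable (\<lambda>l. norm (F l t))" for t
  proof -
    have "summable (\<lambda>l. norm (indicator {0..} t *\<^sub>R (of_real (t ^ k) * exp (- (complex_of_real t)\<^sup>2 / 2))) *
        norm ((\<beta> * of_real t) ^ l /\<^sub>R fact l))"
      by (intro summable_mult summable_norm_exp)
    then show ?thesis unfolding Feq norm_mult .
  qed
  have *: "integrable lborel (F l)" for l using B by (auto simp: has_bochner_integral_iff)
  have **: "summable (\<lambda>l. \<integral>t. norm (F l t) \<partial>lborel)"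
    unfolding N by (rule summable_exp_half_moment) simp
  have f: "f = (\<lambda>t. \<Sum>l. F l t)" using fS by (auto simp: sums_iff)
  show "integrable lborel f" unfolding f
    by (rule integrable_suminf[OF * _ **]) (simp add: sum)
  have "(\<lambda>l. \<integral>t. F l t \<partial>lborel) sums (\<integral>t. (\<Sum>l. F l t) \<partial>lborel)"
    by (rule sums_integral[OF * _ **]) (simp add: sum)
  then have "(\<lambda>l. \<beta> ^ l / fact l * of_real (half_moment (k + l))) sums (\<integral>t. (\<Sum>l. F l t) \<partial>lborel)"
    unfolding has_bochner_integral_integral_eq[OF B] .
  then show "(\<integral>t. f t \<partial>lborel) = half_laplace k \<beta>"
    unfolding f by (rule sums_unique2[OF _ half_laplace_sums])
qed

lemma parabolic_D_neg_eq_half_laplace: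
  "parabolic_D_neg (Suc k) w = exp (- (w\<^sup>2) / 4) / fact k * half_laplace k (- w)"
proof -
  have eq: "- (complex_of_real t)\<^sup>2 / 2 - w * of_real t = - (of_real t)\<^sup>2 / 2 + - w * of_real t" for t
    by simp
  show ?thesis
    unfolding parabolic_D_neg_def set_lebesgue_integral_def eq diff_Suc_1 set_integral_half_laplace(2)
    by (simp add: Gamma_fact add.commute)
qed

text \<open>
  Integration by parts, in terms of the moments: \<open>half_moment (k + 2 + l)\<close> is
  \<open>k + l + 1\<close> times \<open>half_moment (k + l)\<close>, and the part \<open>l\<close> of this factor shifts the exponential series.
\<close>

lemma half_laplace_rec:
  "half_laplace (k + 2) \<beta> = \<beta> * half_laplace (k + 1) \<beta> + (of_nat k + 1) * half_laplace k \<beta>"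
proof -
  define b where "b = (\<lambda>l. if l = 0 then 0 else \<beta> ^ l / fact (l - 1) * complex_of_real (half_moment (k + l)))"
  have "(\<lambda>l. \<beta> * (\<beta> ^ l / fact l * of_real (half_moment (k + 1 + l)))) sums (\<beta> * half_laplace (k + 1) \<beta>)"
    by (intro sums_mult half_laplace_sums)
  moreover have "(\<lambda>l. \<beta> * (\<beta> ^ l / fact l * of_real (half_moment (k + 1 + l)))) = (\<lambda>l. b (Suc l))"
    by (simp add: b_def fun_eq_iff)
  moreover have "b 0 = 0" by (simp add: b_def)
  ultimately have "b sums (\<beta> * half_laplace (k + 1) \<beta>)"
    using sums_Suc_iff[of b "\<beta> * half_laplace (k + 1) \<beta>"] by simp
  moreover have "(\<lambda>l. (of_nat k + 1) * (\<beta> ^ l / fact l * of_real (half_moment (k + l)))) sums ((of_nat k + 1) * half_laplace k \<beta>)"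
    by (intro sums_mult half_laplace_sums)
  ultimately have "(\<lambda>l. b l + (of_nat k + 1) * (\<beta> ^ l / fact l * of_real (half_moment (k + l)))) sums
     (\<beta> * half_laplace (k + 1) \<beta> + (of_nat k + 1) * half_laplace k \<beta>)"
    by (rule sums_add)
  also have "(\<lambda>l. b l + (of_nat k + 1) * (\<beta> ^ l / fact l * of_real (half_moment (k + l)))) =
     (\<lambda>l. \<beta> ^ l / fact l * of_real (half_moment (k + 2 + l)))"
  proof
    fix l
    have "b l = of_nat l * (\<beta> ^ l / fact l * of_real (half_moment (k + l)))"
      unfolding b_def by (cases l) (simp_all add: divide_simps del: of_nat_Suc)
    then show "b l + (of_nat k + 1) * (\<beta> ^ l / fact l * of_real (half_moment (k + l))) =
       \<beta> ^ l / fact l * of_real (half_moment (k + 2 + l))"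
      by (simp add: algebra_simps add_divide_distrib)
  qed
  finally show ?thesis by (rule sums_unique2[OF half_laplace_sums])
qed

lemma half_laplace_1: "half_laplace 1 \<beta> = 1 + \<beta> * half_laplace 0 \<beta>"
proof -
  have "(\<lambda>l. \<beta> * (\<beta> ^ l / fact l * of_real (half_moment (0 + l)))) sums (\<beta> * half_laplace 0 \<beta>)"
    by (intro sums_mult half_laplace_sums)
  also have "(\<lambda>l. \<beta> * (\<beta> ^ l / fact l * of_real (half_moment (0 + l)))) =
      (\<lambda>l. \<beta> ^ Suc l / fact (Suc l) * of_real (half_moment (1 + Suc l)))"
  proof
    fix l
    have 1: "complex_of_real (half_moment (1 + Suc l)) = of_nat (Suc l) * of_real (half_moment l)" by simp
    have 2: "fact (Suc l) = of_nat (Suc l) * (fact l :: complex)" by simp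
    have 3: "x / (c * f) * (c * m) = x / f * m" if "c \<noteq> 0" for x c f m :: complex
      using that by simp
    have "(of_nat (Suc l) :: complex) \<noteq> 0" by (simp only: of_nat_eq_0_iff)
    then show "\<beta> * (\<beta> ^ l / fact l * of_real (half_moment (0 + l))) =
      \<beta> ^ Suc l / fact (Suc l) * of_real (half_moment (1 + Suc l))"
      unfolding 1 2 by (subst 3) simp_all
  qed
  finally have "(\<lambda>l. \<beta> ^ l / fact l * of_real (half_moment (1 + l))) sums (\<beta> * half_laplace 0 \<beta> + 1)"
    by (subst (asm) sums_Suc_iff) simp
  from sums_unique2[OF half_laplace_sums this] show ?thesis by (simp only: add.commute)
qed

text \<open>
  The two half-line integrals make up the Gaussian integral over the whole line. In the series only the even
  powers survive.
\<close>

lemma half_laplace_0_reflect: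
  "half_laplace 0 \<beta> + half_laplace 0 (- \<beta>) = of_real (sqrt (2 * pi)) * exp (\<beta>\<^sup>2 / 2)"
proof -
  define a where "a = (\<lambda>l. \<beta> ^ l / fact l * complex_of_real (half_moment (0 + l)) + (- \<beta>) ^ l / fact l * of_real (half_moment (0 + l)))"
  have "a sums (half_laplace 0 \<beta> + half_laplace 0 (- \<beta>))"
    unfolding a_def by (intro sums_add half_laplace_sums)
  moreover have "a sums (of_real (sqrt (2 * pi)) * exp (\<beta>\<^sup>2 / 2))"
  proof -
    have "(\<lambda>j. of_real (sqrt (2 * pi)) * ((\<beta>\<^sup>2 / 2) ^ j /\<^sub>R fact j)) sums (of_real (sqrt (2 * pi)) * exp (\<beta>\<^sup>2 / 2))"
      by (intro sums_mult exp_converges)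
    also have "(\<lambda>j. of_real (sqrt (2 * pi)) * ((\<beta>\<^sup>2 / 2) ^ j /\<^sub>R fact j)) = (\<lambda>j. a (2 * j))"
    proof
      fix j
      have "a (2 * j) = \<beta> ^ (2 * j) / fact (2 * j) * of_real (2 * half_moment (2 * j))"
        by (simp add: a_def)
      also have "2 * half_moment (2 * j) = sqrt (2 * pi) * (fact (2 * j) / (2 ^ j * fact j))"
        unfolding half_moment_even by (simp add: real_sqrt_divide real_sqrt_mult field_simps)
      also have "\<beta> ^ (2 * j) / fact (2 * j) * of_real (sqrt (2 * pi) * (fact (2 * j) / (2 ^ j * fact j))) =
          of_real (sqrt (2 * pi)) * ((\<beta>\<^sup>2 / 2) ^ j /\<^sub>R fact j)"
        unfolding power_mult by (simp add: power_divide scaleR_conv_of_real field_simps)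
      finally show "of_real (sqrt (2 * pi)) * ((\<beta>\<^sup>2 / 2) ^ j /\<^sub>R fact j) = a (2 * j)" by simp
    qed
    finally show ?thesis
    proof (subst (asm) sums_mono_reindex)
      show "strict_mono (\<lambda>j::nat. 2 * j)" by (simp add: strict_mono_def)
      show "a l = 0" if "l \<notin> range (\<lambda>j. 2 * j)" for l
      proof -
        have "odd l" using that by (auto elim!: evenE)
        then show ?thesis by (simp add: a_def)
      qed
    qed
  qed
  ultimately show ?thesis by (rule sums_unique2)
qed

section \<open>Growth along the ray of the kernel\<close>

lemma norm_half_laplace_neg_le:
  assumes "Re \<beta> \<le> 0"
  shows "norm (half_laplace k \<beta>) \<le> half_moment k"
proof -
  note I = set_integral_half_laplace[of k \<beta>]
  have "norm (half_laplace k \<beta>) \<le> (\<integral>t. indicator {0..} t *\<^sub>R (t ^ k * exp (- t\<^sup>2 / 2)) \<partial>lborel)"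
    unfolding I(2)[symmetric]
  proof (rule Bochner_Integration.integral_norm_bound_integral[OF I(1)])
    show "integrable lborel (\<lambda>t. indicator {0..} t *\<^sub>R (t ^ k * exp (- t\<^sup>2 / 2)) :: real)"
      using has_bochner_integral_half_moment[of k] by (simp add: has_bochner_integral_iff)
    fix t :: real
    show "norm (indicator {0..} t *\<^sub>R (of_real (t ^ k) * exp (- (of_real t)\<^sup>2 / 2 + \<beta> * of_real t)))
        \<le> indicator {0..} t *\<^sub>R (t ^ k * exp (- t\<^sup>2 / 2))"
      using assms by (auto simp: indicator_def norm_mult norm_power mult_nonpos_nonneg power2_eq_square intro!: mult_left_mono)
  qed
  also have "\<dots> = half_moment k"
    by (rule has_bochner_integral_integral_eq[OF has_bochner_integral_half_moment])
  finally show ?thesis .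
qed

lemma norm_half_laplace_0_le:
  assumes "Re \<beta> < 0"
  shows "norm (half_laplace 0 \<beta>) \<le> 1 / (- Re \<beta>)"
proof -
  note I = set_integral_half_laplace[of 0 \<beta>]
  have H: "has_bochner_integral lborel (\<lambda>t. indicator {0..} t *\<^sub>R exp (- (t * (- Re \<beta>)))) (1 / (- Re \<beta>))"
  proof -
    have "has_bochner_integral lborel
        (\<lambda>t. indicator {0..} (0 + (- Re \<beta>) * t) *\<^sub>R ((0 + (- Re \<beta>) * t) ^ 0 * exp (- (0 + (- Re \<beta>) * t))))
        (fact 0 /\<^sub>R \<bar>- Re \<beta>\<bar>)"
      using assms has_bochner_integral_power_exp[of 0]
      by (subst lborel_has_bochner_integral_real_affine_iff[symmetric]) auto
    moreover have "indicator {0..} (0 + (- Re \<beta>) * t) = (indicator {0..} t :: real)" for t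
      using assms by (auto simp: indicator_def mult_le_0_iff)
    ultimately show ?thesis using assms by (simp add: mult.commute inverse_eq_divide)
  qed
  have "norm (half_laplace 0 \<beta>) \<le> (\<integral>t. indicator {0..} t *\<^sub>R exp (- (t * (- Re \<beta>))) \<partial>lborel)"
    unfolding I(2)[symmetric]
  proof (rule Bochner_Integration.integral_norm_bound_integral[OF I(1)])
    show "integrable lborel (\<lambda>t. indicator {0..} t *\<^sub>R exp (- (t * (- Re \<beta>))))"
      using H by (simp add: has_bochner_integral_iff)
    fix t :: real
    show "norm (indicator {0..} t *\<^sub>R (of_real (t ^ 0) * exp (- (of_real t)\<^sup>2 / 2 + \<beta> * of_real t)))
        \<le> indicator {0..} t *\<^sub>R exp (- (t * (- Re \<beta>)))"
      by (auto simp: indicator_def norm_mult power2_eq_square mult.commute)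
  qed
  also have "\<dots> = 1 / (- Re \<beta>)"
    by (rule has_bochner_integral_integral_eq[OF H])
  finally show ?thesis .
qed

lemma norm_exp_half_square: "norm (exp (((1 - \<i>) * of_real u)\<^sup>2 / 2)) = 1"
proof -
  have "((1 - \<i>) * of_real u)\<^sup>2 / 2 = \<i> * of_real (- u\<^sup>2)"
    by (simp add: power2_eq_square algebra_simps)
  then show ?thesis by (simp only: norm_exp_i_times)
qed

text \<open>
  For \<open>k = 0\<close> and \<open>u > 0\<close> the modulus of the integrand reaches \<open>exp (u\<^sup>2 / 2)\<close>, and only
  oscillation keeps the integral bounded. Reflection at \<open>0\<close> extracts this cancellation: it trades the integral
  for a unimodular Gaussian and an integral with decaying integrand.
\<close>

lemma half_laplace_growth:
  "\<exists>C>0. \<forall>u. norm (half_laplace k ((1 - \<i>) * of_real u)) \<le> C * (1 + \<bar>u\<bar>) ^ k"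
proof (induction k rule: less_induct)
  case (less k)
  define \<beta> :: "real \<Rightarrow> complex" where "\<beta> = (\<lambda>u. (1 - \<i>) * of_real u)"
  have n\<beta>: "norm (\<beta> u) \<le> 2 * (1 + \<bar>u\<bar>)" for u
  proof -
    have "norm (\<beta> u) \<le> (norm (1::complex) + norm \<i>) * \<bar>u\<bar>"
      unfolding \<beta>_def norm_mult by (intro mult_mono norm_triangle_ineq4) auto
    then show ?thesis by simp
  qed
  consider "k = 0" | "k = 1" | k' where "k = k' + 2"
    by (metis One_nat_def add_2_eq_Suc' not0_implies_Suc)
  then show ?case
  proof cases
    case 1
    define C where "C = sqrt (2 * pi) + half_moment 0"
    have "C > 0" unfolding C_def using half_moment_nonneg[of 0] by (intro add_pos_nonneg) auto
    moreover have "norm (half_laplace 0 (\<beta> u)) \<le> C" for u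
    proof (cases "u \<le> 0")
      case True
      then have "norm (half_laplace 0 (\<beta> u)) \<le> half_moment 0"
        by (intro norm_half_laplace_neg_le) (simp add: \<beta>_def)
      also have "\<dots> \<le> C" by (simp add: C_def)
      finally show ?thesis .
    next
      case False
      have "half_laplace 0 (\<beta> u) = of_real (sqrt (2 * pi)) * exp ((\<beta> u)\<^sup>2 / 2) - half_laplace 0 (- \<beta> u)"
        by (simp add: half_laplace_0_reflect[symmetric])
      also have "norm \<dots> \<le> norm (of_real (sqrt (2 * pi)) * exp ((\<beta> u)\<^sup>2 / 2)) + norm (half_laplace 0 (- \<beta> u))"
        by (rule norm_triangle_ineq4)
      also have "norm (of_real (sqrt (2 * pi)) * exp ((\<beta> u)\<^sup>2 / 2)) = sqrt (2 * pi)"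
        unfolding norm_mult \<beta>_def norm_exp_half_square by simp
      also have "norm (half_laplace 0 (- \<beta> u)) \<le> half_moment 0"
        using False by (intro norm_half_laplace_neg_le) (simp add: \<beta>_def)
      finally show ?thesis by (simp add: C_def)
    qed
    ultimately show ?thesis using 1 unfolding \<beta>_def by auto
  next
    case 2
    then obtain C where C: "C > 0" "\<And>u. norm (half_laplace 0 (\<beta> u)) \<le> C"
      using less[of 0] unfolding \<beta>_def by auto
    have "norm (half_laplace 1 (\<beta> u)) \<le> (1 + 2 * C) * (1 + \<bar>u\<bar>)" for u
    proof -
      have "norm (half_laplace 1 (\<beta> u)) \<le> norm (1::complex) + norm (\<beta> u) * norm (half_laplace 0 (\<beta> u))"
        unfolding half_laplace_1 norm_mult[symmetric] by (rule norm_triangle_ineq)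
      also have "\<dots> \<le> 1 * (1 + \<bar>u\<bar>) + 2 * (1 + \<bar>u\<bar>) * C"
        using C n\<beta> by (intro add_mono mult_mono) auto
      finally show ?thesis by (simp add: algebra_simps)
    qed
    moreover have "1 + 2 * C > 0" using C by simp
    ultimately show ?thesis using 2 unfolding \<beta>_def by auto
  next
    case 3
    obtain C where C: "C > 0" "\<And>u. norm (half_laplace k' (\<beta> u)) \<le> C * (1 + \<bar>u\<bar>) ^ k'"
      using less[of k'] 3 unfolding \<beta>_def by auto
    obtain D where D: "D > 0" "\<And>u. norm (half_laplace (k' + 1) (\<beta> u)) \<le> D * (1 + \<bar>u\<bar>) ^ (k' + 1)"
      using less[of "k' + 1"] 3 unfolding \<beta>_def by auto
    have "norm (half_laplace k (\<beta> u)) \<le> (2 * D + (real k' + 1) * C) * (1 + \<bar>u\<bar>) ^ k" for u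
    proof -
      have "norm (half_laplace k (\<beta> u)) \<le>
         norm (\<beta> u) * norm (half_laplace (k' + 1) (\<beta> u)) + norm (of_nat k' + 1 :: complex) * norm (half_laplace k' (\<beta> u))"
        unfolding 3 half_laplace_rec norm_mult[symmetric] by (rule norm_triangle_ineq)
      also have "norm (of_nat k' + 1 :: complex) = real k' + 1"
        by (metis norm_of_nat of_nat_Suc add.commute)
      also have "norm (\<beta> u) * norm (half_laplace (k' + 1) (\<beta> u)) \<le> 2 * (1 + \<bar>u\<bar>) * (D * (1 + \<bar>u\<bar>) ^ (k' + 1))"
        using D n\<beta> by (intro mult_mono) auto
      also have "\<dots> = 2 * D * (1 + \<bar>u\<bar>) ^ k" by (simp add: 3)
      also have "(real k' + 1) * norm (half_laplace k' (\<beta> u)) \<le> (real k' + 1) * (C * (1 + \<bar>u\<bar>) ^ k)"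
      proof (intro mult_left_mono order.trans[OF C(2)])
        show "(1 + \<bar>u\<bar>) ^ k' \<le> (1 + \<bar>u\<bar>) ^ k" by (rule power_increasing) (auto simp: 3)
      qed (use C in auto)
      finally show ?thesis by (simp add: algebra_simps)
    qed
    moreover have "2 * D + (real k' + 1) * C > 0" using C D by (intro add_pos_pos) auto
    ultimately show ?thesis unfolding \<beta>_def by auto
  qed
qed

text \<open>
  Divided by the unimodular \<open>exp (\<beta>\<^sup>2 / 2)\<close>, where \<open>\<beta> = (1 - \<i>) * u\<close>, the functions themselves converge
  after scaling by \<open>u ^ k\<close>, to \<open>(1 - \<i>) ^ k * sqrt (2 * pi)\<close>. This stronger claim is the one that passes
  through the recurrence, in which the term of index \<open>k - 2\<close> is of relative order \<open>1 / u\<^sup>2\<close>.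
\<close>

lemma half_laplace_asymptotic:
  "((\<lambda>u. norm (half_laplace k ((1 - \<i>) * of_real u)) / u ^ k) \<longlongrightarrow> sqrt 2 ^ k * sqrt (2 * pi)) at_top"
proof -
  define E where "E = (\<lambda>u::real. exp (((1 - \<i>) * complex_of_real u)\<^sup>2 / 2))"
  have nE: "norm (E u) = 1" for u unfolding E_def by (rule norm_exp_half_square)
  define J where "J = (\<lambda>k u. half_laplace k ((1 - \<i>) * of_real u) / (E u * of_real u ^ k))"
  define L where "L = complex_of_real (sqrt (2 * pi))"
  \<comment> \<open>Multiplying by the unimodular \<open>inverse (E u)\<close> does not affect convergence to zero.\<close>
  have bdd: "((\<lambda>u. inverse (E u) * f u) \<longlongrightarrow> 0) at_top" if "(f \<longlongrightarrow> 0) at_top" for f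
    using that by (subst tendsto_norm_zero_iff[symmetric]) (simp add: norm_mult norm_inverse nE tendsto_norm_zero)
  have inv0: "((\<lambda>u. inverse (complex_of_real u)) \<longlongrightarrow> 0) at_top"
    by (subst tendsto_norm_zero_iff[symmetric])
       (simp add: norm_inverse tendsto_inverse_0_at_top filterlim_abs_real)
  have ev: "eventually (\<lambda>u::real. u > 0) at_top" by (rule eventually_gt_at_top)
  have J0: "(J 0 \<longlongrightarrow> L) at_top"
  proof -
    have "((\<lambda>u. half_laplace 0 (- ((1 - \<i>) * of_real u))) \<longlongrightarrow> 0) at_top"
    proof (rule Lim_null_comparison)
      show "eventually (\<lambda>u. norm (half_laplace 0 (- ((1 - \<i>) * of_real u))) \<le> 1 / u) at_top"
        using ev by eventually_elim (rule order.trans[OF norm_half_laplace_0_le]; simp)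
      show "((\<lambda>u::real. 1 / u) \<longlongrightarrow> 0) at_top" by (rule tendsto_divide_0[OF tendsto_const]) (rule filterlim_at_top_imp_at_infinity[OF filterlim_ident])
    qed
    then have "((\<lambda>u. L - inverse (E u) * half_laplace 0 (- ((1 - \<i>) * of_real u))) \<longlongrightarrow> L - 0) at_top"
      by (intro tendsto_diff tendsto_const bdd)
    moreover have "L - inverse (E u) * half_laplace 0 (- ((1 - \<i>) * of_real u)) = J 0 u" for u
    proof -
      have "E u \<noteq> 0" by (simp add: E_def)
      moreover have "half_laplace 0 ((1 - \<i>) * of_real u) + half_laplace 0 (- ((1 - \<i>) * of_real u)) = L * E u"
        unfolding half_laplace_0_reflect L_def E_def ..
      ultimately show ?thesis by (simp add: J_def field_simps)
    qed
    ultimately show ?thesis by simp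
  qed
  have J: "(J k \<longlongrightarrow> (1 - \<i>) ^ k * L) at_top" for k
  proof (induction k rule: less_induct)
    case (less k)
    consider "k = 0" | "k = 1" | k' where "k = k' + 2"
      by (metis One_nat_def add_2_eq_Suc' not0_implies_Suc)
    then show ?case
    proof cases
      case 1
      then show ?thesis using J0 by simp
    next
      case 2
      have "((\<lambda>u. inverse (E u) * inverse (of_real u) + (1 - \<i>) * J 0 u) \<longlongrightarrow> 0 + (1 - \<i>) * L) at_top"
        by (intro tendsto_intros bdd inv0 J0)
      moreover have "eventually (\<lambda>u. inverse (E u) * inverse (of_real u) + (1 - \<i>) * J 0 u = J 1 u) at_top"
        using ev by eventually_elim (simp add: J_def half_laplace_1[simplified] E_def field_simps)
      ultimately show ?thesis using 2 by (simp add: tendsto_cong)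
    next
      case 3
      have "((\<lambda>u. (1 - \<i>) * J (k' + 1) u + (of_nat k' + 1) * (inverse (of_real u) * inverse (of_real u) * J k' u)) \<longlongrightarrow>
          (1 - \<i>) * ((1 - \<i>) ^ (k' + 1) * L) + (of_nat k' + 1) * (0 * 0 * ((1 - \<i>) ^ k' * L))) at_top"
        using less[of k'] less[of "k' + 1"] 3 by (intro tendsto_mult tendsto_add tendsto_const inv0) simp_all
      moreover have "eventually (\<lambda>u. (1 - \<i>) * J (k' + 1) u + (of_nat k' + 1) * (inverse (of_real u) * inverse (of_real u) * J k' u) = J k u) at_top"
        using ev
      proof eventually_elim
        case (elim u)
        then show ?case unfolding J_def 3 half_laplace_rec by (simp add: E_def field_simps)
      qed
      ultimately show ?thesis using 3 by (simp add: tendsto_cong mult.assoc)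
    qed
  qed
  have "((\<lambda>u. norm (J k u)) \<longlongrightarrow> norm ((1 - \<i>) ^ k * L)) at_top"
    by (intro tendsto_norm J)
  moreover have "norm ((1 - \<i>) ^ k * L) = sqrt 2 ^ k * sqrt (2 * pi)"
  proof -
    have "norm (1 - \<i>) = sqrt 2" by (simp add: cmod_def)
    then show ?thesis by (simp add: norm_mult norm_power L_def)
  qed
  moreover have "eventually (\<lambda>u. norm (J k u) = norm (half_laplace k ((1 - \<i>) * of_real u)) / u ^ k) at_top"
    using ev by eventually_elim (simp add: J_def norm_divide norm_mult norm_power nE)
  ultimately show ?thesis by (simp add: tendsto_cong)
qed

section \<open>Gegenbauer and Chebyshev polynomials in uniform normalisation\<close>

text \<open>
  The polynomial \<open>(lam + k) / lam * gegenbauer k lam \<xi>\<close>, written so that \<open>lam = 0\<close> yields its limit, which is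
  \<open>1\<close> for \<open>k = 0\<close> and twice the Chebyshev polynomial of the first kind for \<open>k \<ge> 1\<close>. Dimension 2 is thus
  covered by the same summation.
\<close>

definition normalized_gegenbauer :: "nat \<Rightarrow> nat \<Rightarrow> real \<Rightarrow> real" where
  "normalized_gegenbauer lam k \<xi> =
     (\<Sum>i\<le>k div 2. (- 1) ^ i * (fact (lam + (k - 2 * i)) / (fact lam * fact (k - 2 * i)) *
        gegen_weight (real (lam + (k - 2 * i)) / 2) i) * (2 * \<xi>) ^ (k - 2 * i))"

lemma pochhammer_Suc_nat: "pochhammer (real n + 1) k = fact (n + k) / fact n"
  by (induction k) (simp_all add: pochhammer_Suc algebra_simps add_divide_distrib)

lemma gegen_weight_nat:
  "gegen_weight (real (Suc m) / 2) i = fact (m + i) * (real m + 1 + 2 * real i) / (fact (Suc m) * fact i)"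
proof (cases i)
  case 0
  then show ?thesis by (simp add: gegen_weight_def)
next
  case (Suc i')
  have p: "pochhammer (2 * (real (Suc m) / 2) + 1) j = fact (Suc m + j) / fact (Suc m)" for j
  proof -
    have "2 * (real (Suc m) / 2) + 1 = real (Suc m) + 1" by simp
    then show ?thesis by (simp only: pochhammer_Suc_nat)
  qed
  have f: "fact (Suc m + Suc i') = (real m + real i' + 2) * fact (m + Suc i')"
    "fact (Suc i') = (real i' + 1) * fact i'" "(fact (Suc m + i') :: real) = fact (m + Suc i')"
    by (simp_all add: algebra_simps)
  have gen: "(c * F) / (G * (r * g)) + F / (G * g) = F * d / (G * (r * g))"
    if "c + r = d" "r > 0" "G > 0" "g > 0" for c F G r g d :: real
    using that(2-) unfolding that(1)[symmetric] by (simp add: field_simps)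
  show ?thesis
    unfolding gegen_weight_def p Suc f diff_Suc_1
    by (simp del: fact_Suc add: f) (rule gen; simp del: fact_Suc)
qed

lemma normalized_gegenbauer_eq:
  assumes "lam \<ge> 1"
  shows "normalized_gegenbauer lam k \<xi> = (real lam + real k) / real lam * gegenbauer k (real lam) \<xi>"
  unfolding normalized_gegenbauer_def gegenbauer_def sum_distrib_left
proof (intro sum.cong refl)
  fix i assume "i \<in> {..k div 2}"
  then obtain l where k: "k = l + 2 * i" by (metis atMost_iff le_add_diff_inverse2 div_times_less_eq_dividend le_trans mult.commute mult_le_mono1)
  obtain m where m: "lam = Suc m" using assms by (cases lam) auto
  have g: "gegen_weight (real (lam + l) / 2) i =
      fact (m + l + i) * (real m + real l + 1 + 2 * real i) / (fact (lam + l) * fact i)"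
    using gegen_weight_nat[of "m + l" i] by (simp add: m)
  have p: "pochhammer (real lam) (l + i) = fact (m + l + i) / fact m"
    using pochhammer_Suc_nat[of m "l + i"] by (simp add: m add.commute add.left_commute)
  have f: "fact lam = real lam * fact m" by (simp add: m)
  have gen: "e * (F / (L * f * g) * (G * r / (F * t))) * x = s / L * (e * (G / f) / (t * g) * x)"
    if "r = s" "F > 0" "L > 0" "f > 0" "g > 0" "t > 0" for e F L f g G r t s x :: real
    using that by (simp add: mult_ac)
  show "(- 1) ^ i * (fact (lam + (k - 2 * i)) / (fact lam * fact (k - 2 * i)) *
        gegen_weight (real (lam + (k - 2 * i)) / 2) i) * (2 * \<xi>) ^ (k - 2 * i) =
     (real lam + real k) / real lam * ((- 1) ^ i * pochhammer (real lam) (k - i) / (fact i * fact (k - 2 * i)) *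
        (2 * \<xi>) ^ (k - 2 * i))"
  proof -
    have "k - 2 * i = l" "k - i = l + i" by (auto simp: k)
    then show ?thesis
      unfolding g p f
      by (simp only: g p f) (rule gen; simp add: k m)
  qed
qed

text \<open>
  The Chebyshev polynomial of the second kind in the variable \<open>x = 2 * cos \<theta>\<close>. Summing up to \<open>k\<close> rather than
  \<open>k div 2\<close> is harmless, as the additional binomial coefficients vanish, and avoids parity cases.
\<close>

definition chebyshev_U_sum :: "nat \<Rightarrow> real \<Rightarrow> real" where
  "chebyshev_U_sum k x = (\<Sum>i\<le>k. (- 1) ^ i * real ((k - i) choose i) * x ^ (k - 2 * i))"

lemma chebyshev_U_sum_Suc:
  "chebyshev_U_sum (Suc k) x = x ^ Suc k +
     (\<Sum>i\<le>k. (- 1) ^ Suc i * real ((Suc k - Suc i) choose Suc i) * x ^ (Suc k - 2 * Suc i))"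
  unfolding chebyshev_U_sum_def sum.atMost_Suc_shift by simp

lemma chebyshev_U_sum_rec:
  "chebyshev_U_sum (k + 2) x = x * chebyshev_U_sum (k + 1) x - chebyshev_U_sum k x"
proof -
  have "chebyshev_U_sum (k + 2) x = x ^ (k + 2) +
      (\<Sum>i\<le>k + 1. (- 1) ^ Suc i * real ((k + 2 - Suc i) choose Suc i) * x ^ (k + 2 - 2 * Suc i))"
    using chebyshev_U_sum_Suc[of "k + 1" x] by simp
  also have "(\<Sum>i\<le>k + 1. (- 1) ^ Suc i * real ((k + 2 - Suc i) choose Suc i) * x ^ (k + 2 - 2 * Suc i)) =
      (\<Sum>i\<le>k. (- 1) ^ Suc i * real ((k + 2 - Suc i) choose Suc i) * x ^ (k + 2 - 2 * Suc i))"
    by simp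
  also have "\<dots> = (\<Sum>i\<le>k. x * ((- 1) ^ Suc i * real ((k + 1 - Suc i) choose Suc i) * x ^ (k + 1 - 2 * Suc i))
      - (- 1) ^ i * real ((k - i) choose i) * x ^ (k - 2 * i))"
  proof (intro sum.cong refl)
    fix i assume i: "i \<in> {..k}"
    have "k + 2 - Suc i = Suc (k - i)" using i by auto
    then have 1: "(k + 2 - Suc i) choose Suc i = (k - i choose i) + (k - i choose Suc i)" by simp
    have 2: "x * (real (k - i choose Suc i) * x ^ (k + 1 - 2 * Suc i)) = real (k - i choose Suc i) * x ^ (k - 2 * i)"
    proof (cases "2 * i < k")
      case True
      then have "k - 2 * i = Suc (k + 1 - 2 * Suc i)" by simp
      then show ?thesis by simp
    next
      case False
      then have "k - i choose Suc i = 0" by (intro binomial_eq_0) auto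
      then show ?thesis by simp
    qed
    have 3: "k + 1 - Suc i = k - i" "k + 2 - 2 * Suc i = k - 2 * i" by auto
    show "(- 1) ^ Suc i * real ((k + 2 - Suc i) choose Suc i) * x ^ (k + 2 - 2 * Suc i) =
      x * ((- 1) ^ Suc i * real ((k + 1 - Suc i) choose Suc i) * x ^ (k + 1 - 2 * Suc i))
      - (- 1) ^ i * real ((k - i) choose i) * x ^ (k - 2 * i)"
      unfolding 1 3 using arg_cong[OF 2, of "\<lambda>y. (- 1) ^ i * y"]
      by (auto simp: algebra_simps)
  qed
  also have "\<dots> = x * (\<Sum>i\<le>k. (- 1) ^ Suc i * real ((k + 1 - Suc i) choose Suc i) * x ^ (k + 1 - 2 * Suc i))
      - chebyshev_U_sum k x"
    unfolding sum_subtractf sum_distrib_left chebyshev_U_sum_def ..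
  also have "x ^ (k + 2) + \<dots> = x * chebyshev_U_sum (k + 1) x - chebyshev_U_sum k x"
    using arg_cong[OF chebyshev_U_sum_Suc[of k x], of "\<lambda>y. x * y"] by (simp add: distrib_left)
  finally show ?thesis .
qed

text \<open>
  This is \<open>U k - U (k - 2) = 2 * T k\<close>. Both sides obey the same three-term recurrence.
\<close>

lemma chebyshev_U_sum_diff_cos:
  "chebyshev_U_sum (k + 2) (2 * cos \<theta>) - chebyshev_U_sum k (2 * cos \<theta>) = 2 * cos (real (k + 2) * \<theta>)"
proof (induction k rule: induct_nat_012)
  case 0
  show ?case by (simp add: chebyshev_U_sum_def eval_nat_numeral cos_double_cos)
next
  case 1
  have "cos (3 * \<theta>) = 4 * cos \<theta> ^ 3 - 3 * cos \<theta>" by (rule cos_treble_cos)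
  then show ?case by (simp add: chebyshev_U_sum_def eval_nat_numeral algebra_simps)
next
  case (ge2 k)
  let ?x = "2 * cos \<theta>"
  have "cos (real (k + 4) * \<theta>) = 2 * cos \<theta> * cos (real (k + 3) * \<theta>) - cos (real (k + 2) * \<theta>)"
  proof -
    have "cos (real (k + 3) * \<theta> + \<theta>) + cos (real (k + 3) * \<theta> - \<theta>) = 2 * cos \<theta> * cos (real (k + 3) * \<theta>)"
      by (simp add: cos_add cos_diff)
    moreover have "real (k + 3) * \<theta> + \<theta> = real (k + 4) * \<theta>" "real (k + 3) * \<theta> - \<theta> = real (k + 2) * \<theta>"
      by (simp_all add: algebra_simps)
    ultimately show ?thesis by (simp only: eq_diff_eq)
  qed
  moreover have "chebyshev_U_sum (k + 4) ?x - chebyshev_U_sum (k + 2) ?x =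
     ?x * (chebyshev_U_sum (k + 3) ?x - chebyshev_U_sum (k + 1) ?x) - (chebyshev_U_sum (k + 2) ?x - chebyshev_U_sum k ?x)"
    using chebyshev_U_sum_rec[of "k + 2" ?x] chebyshev_U_sum_rec[of k ?x] by (simp add: algebra_simps eval_nat_numeral)
  ultimately show ?case using ge2
    by (simp add: algebra_simps eval_nat_numeral)
qed

text \<open>
  The two summands of \<open>gegen_weight\<close> become the binomial coefficients of the two Chebyshev sums in
  \<open>chebyshev_U_sum_diff_cos\<close>; for \<open>k = 1\<close> the second one is empty.
\<close>

lemma normalized_gegenbauer_0_cos:
  assumes "k \<ge> 1"
  shows "normalized_gegenbauer 0 k (cos \<theta>) = 2 * cos (real k * \<theta>)"
proof -
  let ?x = "2 * cos \<theta>"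
  define U where "U = chebyshev_U_sum k ?x"
  define V where "V = (if k = 1 then 0 else chebyshev_U_sum (k - 2) ?x)"
  have w: "gegen_weight (real l / 2) i = real ((l + i) choose i) + (if i = 0 then 0 else real ((l + i - 1) choose (i - 1)))" for l i
  proof -
    have p: "pochhammer (2 * (real l / 2) + 1) j / fact j = real ((l + j) choose j)" for j
      using pochhammer_Suc_nat[of l j] by (simp add: binomial_fact)
    show ?thesis unfolding gegen_weight_def p by (cases i) auto
  qed
  have "normalized_gegenbauer 0 k (cos \<theta>) =
     (\<Sum>i\<le>k div 2. (- 1) ^ i * real ((k - i) choose i) * ?x ^ (k - 2 * i)) +
     (\<Sum>i\<le>k div 2. if i = 0 then 0 else (- 1) ^ i * real ((k - i - 1) choose (i - 1)) * ?x ^ (k - 2 * i))"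
    unfolding normalized_gegenbauer_def sum.distrib[symmetric]
  proof (intro sum.cong refl)
    fix i assume "i \<in> {..k div 2}"
    then have "k - 2 * i + i = k - i" by auto
    then have W: "gegen_weight (real (k - 2 * i) / 2) i =
        real ((k - i) choose i) + (if i = 0 then 0 else real ((k - i - 1) choose (i - 1)))"
      by (simp only: w)
    have gen: "e * (f / (1 * f) * (a + (if b then 0 else c))) * y = e * a * y + (if b then 0 else e * c * y)"
      if "f \<noteq> 0" for e f a c y :: real and b
      using that by (simp add: algebra_simps)
    show "(- 1) ^ i * (fact (0 + (k - 2 * i)) / (fact 0 * fact (k - 2 * i)) *
        gegen_weight (real (0 + (k - 2 * i)) / 2) i) * ?x ^ (k - 2 * i) =
       (- 1) ^ i * real ((k - i) choose i) * ?x ^ (k - 2 * i) +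
       (if i = 0 then 0 else (- 1) ^ i * real ((k - i - 1) choose (i - 1)) * ?x ^ (k - 2 * i))"
      unfolding add_0 W fact_0 by (rule gen) simp
  qed
  also have "(\<Sum>i\<le>k div 2. (- 1) ^ i * real ((k - i) choose i) * ?x ^ (k - 2 * i)) = U"
    unfolding U_def chebyshev_U_sum_def
    by (intro sum.mono_neutral_left) (auto intro!: binomial_eq_0)
  also have "(\<Sum>i\<le>k div 2. if i = 0 then 0 else (- 1) ^ i * real ((k - i - 1) choose (i - 1)) * ?x ^ (k - 2 * i)) = - V"
  proof (cases "k = 1")
    case True
    then show ?thesis by (simp add: V_def)
  next
    case False
    define k' where "k' = k - 2"
    have k: "k = k' + 2" using False assms by (simp add: k'_def)
    have d: "k div 2 = Suc (k' div 2)" by (simp add: k)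
    have "(\<Sum>i\<le>k div 2. if i = 0 then 0 else (- 1) ^ i * real ((k - i - 1) choose (i - 1)) * ?x ^ (k - 2 * i)) =
       (\<Sum>i\<le>k' div 2. - ((- 1) ^ i * real ((k' - i) choose i) * ?x ^ (k' - 2 * i)))"
      unfolding d sum.atMost_Suc_shift by (simp add: k)
    also have "\<dots> = - V"
      unfolding sum_negf V_def chebyshev_U_sum_def using False
      by (auto intro!: sum.mono_neutral_left binomial_eq_0 simp: k)
    finally show ?thesis .
  qed
  also have "U + - V = 2 * cos (real k * \<theta>)"
  proof (cases "k = 1")
    case True
    then show ?thesis by (simp add: U_def V_def chebyshev_U_sum_def)
  next
    case False
    then obtain k' where "k = k' + 2" using assms by (metis add.commute le_Suc_ex numeral_2_eq_2 not_less_eq_eq One_nat_def le_antisym)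
    then show ?thesis using chebyshev_U_sum_diff_cos[of k' \<theta>] False
      by (simp add: U_def V_def)
  qed
  finally show ?thesis .
qed

lemma normalized_gegenbauer_0_0: "normalized_gegenbauer 0 0 \<xi> = 1"
  by (simp add: normalized_gegenbauer_def gegen_weight_def)

section \<open>Rearranging the triple series\<close>

definition kernel_coeff :: "nat \<Rightarrow> nat \<Rightarrow> real" where
  "kernel_coeff lam l = fact (lam + l) / (fact lam * fact l)"

text \<open>
  Up to the factor \<open>Gamma ((n + 1) / 2)\<close>, the part of the kernel series that comes from the term \<open>j\<close> of the
  Bessel series and the term \<open>i\<close> of the Gegenbauer polynomial of degree \<open>l + 2 * i\<close>.
\<close>

definition kernel_term :: "nat \<Rightarrow> real \<Rightarrow> complex \<Rightarrow> nat \<Rightarrow> nat \<Rightarrow> nat \<Rightarrow> complex" where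
  "kernel_term lam \<xi> s l i j =
     of_real ((- 1) ^ i * kernel_coeff lam l * gegen_weight (real (lam + l) / 2) i * (2 * \<xi>) ^ l
        * rGamma (real (lam + l) / 2 + 1 + real (i + j)) / fact j) * s ^ (l + 2 * i + 4 * j)"

text \<open>
  For fixed \<open>l\<close> and \<open>p = i + 2 * j\<close> all terms are nonnegative multiples of one complex number,
  since \<open>(- 1) ^ i = (- 1) ^ p\<close>. Therefore the sum of the moduli is the modulus of the sum, so the triple
  series converges absolutely because the product series does.
\<close>

lemma kernel_term_antidiagonal:
  fixes lam l p :: nat and \<xi> :: real and s :: complex
  defines "B \<equiv> of_real (kernel_coeff lam l * rGamma (real (lam + l) / 2 + 1)) * (of_real (2 * \<xi>) * s) ^ l
     * ((- 2 * s\<^sup>2) ^ p / fact p)"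
  shows "(\<Sum>j\<le>p div 2. kernel_term lam \<xi> s l (p - 2 * j) j) = B"
    and "(\<Sum>j\<le>p div 2. norm (kernel_term lam \<xi> s l (p - 2 * j) j)) = norm B"
proof -
  define h where "h = real (lam + l) / 2"
  have h: "h \<ge> 0" by (simp add: h_def)
  define c where "c = of_real ((- 1) ^ p * kernel_coeff lam l * (2 * \<xi>) ^ l) * s ^ (l + 2 * p)"
  define a where "a = (\<lambda>j. gegen_weight h (p - 2 * j) * rGamma (h + 1 + real (p - j)) / fact j)"
  have a_nonneg: "a j \<ge> 0" for j
    using gegen_weight_pos[OF h, of "p - 2 * j"] Gamma_real_pos[of "h + 1 + real (p - j)"] h
    by (simp add: a_def rGamma_inverse_Gamma)
  have t: "kernel_term lam \<xi> s l (p - 2 * j) j = c * of_real (a j)" if "j \<le> p div 2" for j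
  proof -
    have e: "l + 2 * (p - 2 * j) + 4 * j = l + 2 * p" "p - 2 * j + j = p - j" using that by auto
    have "even p \<longleftrightarrow> even (p - 2 * j)" using that by auto
    then have "(- 1) ^ (p - 2 * j) = ((- 1) ^ p :: real)" by (simp add: minus_one_power_iff)
    then show ?thesis
      unfolding kernel_term_def e h_def[symmetric] by (simp add: c_def a_def mult_ac)
  qed
  have sa: "(\<Sum>j\<le>p div 2. a j) = 2 ^ p / fact p * rGamma (h + 1)"
    unfolding a_def by (rule gegen_weight_sum_rGamma[OF h])
  have B: "B = c * of_real (2 ^ p / fact p * rGamma (h + 1))"
  proof -
    have "(- 2 * s\<^sup>2) ^ p = (- 1) ^ p * 2 ^ p * s ^ (2 * p)"
      by (simp add: power_mult power_mult_distrib[symmetric])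
    then show ?thesis
      by (simp add: B_def c_def h_def power_add power_mult_distrib mult_ac)
  qed
  show "(\<Sum>j\<le>p div 2. kernel_term lam \<xi> s l (p - 2 * j) j) = B"
    unfolding B sa[symmetric] of_real_sum sum_distrib_left by (intro sum.cong) (auto simp: t)
  have "norm B = norm c * (\<Sum>j\<le>p div 2. a j)"
    unfolding B sa[symmetric] norm_mult norm_of_real using sum_nonneg[of "{..p div 2}" a] a_nonneg by simp
  also have "\<dots> = (\<Sum>j\<le>p div 2. norm (kernel_term lam \<xi> s l (p - 2 * j) j))"
    unfolding sum_distrib_left by (intro sum.cong) (auto simp: t norm_mult a_nonneg)
  finally show "(\<Sum>j\<le>p div 2. norm (kernel_term lam \<xi> s l (p - 2 * j) j)) = norm B" ..
qed

lemma kernel_term_row: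
  "(\<Sum>i\<le>k div 2. kernel_term lam \<xi> s (k - 2 * i) i j) =
     of_real (rGamma (real (k + lam) / 2 + 1 + real j) / fact j) * s ^ (k + 4 * j) *
     of_real (normalized_gegenbauer lam k \<xi>)"
proof -
  have "kernel_term lam \<xi> s (k - 2 * i) i j = of_real (rGamma (real (k + lam) / 2 + 1 + real j) / fact j) * s ^ (k + 4 * j) *
     of_real ((- 1) ^ i * (fact (lam + (k - 2 * i)) / (fact lam * fact (k - 2 * i)) *
        gegen_weight (real (lam + (k - 2 * i)) / 2) i) * (2 * \<xi>) ^ (k - 2 * i))" if i: "i \<le> k div 2" for i
  proof -
    define l where "l = k - 2 * i"
    have e: "l + 2 * i + 4 * j = k + 4 * j"
      "real (lam + l) / 2 + 1 + real (i + j) = real (k + lam) / 2 + 1 + real j"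
      using i by (auto simp: l_def field_simps)
    show ?thesis unfolding kernel_term_def kernel_coeff_def l_def[symmetric] e by (simp add: mult_ac)
  qed
  then show ?thesis
    unfolding normalized_gegenbauer_def of_real_sum sum_distrib_left by (intro sum.cong) auto
qed

lemma kernel_coeff_sums:
  fixes \<xi> :: real and s :: complex and lam :: nat
  defines "b \<equiv> \<lambda>l. of_real (kernel_coeff lam l * rGamma (real (lam + l) / 2 + 1)) * (of_real (2 * \<xi>) * s) ^ l"
  shows "b sums (of_real (2 powr ((real lam + 1) / 2) / (sqrt pi * fact lam)) *
      half_laplace lam (of_real (2 * sqrt 2 * \<xi>) * s))"
    and "summable (\<lambda>l. norm (b l))"
proof -
  let ?\<kappa> = "2 powr ((real lam + 1) / 2) / (sqrt pi * fact lam)"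
  let ?\<beta> = "of_real (2 * sqrt 2 * \<xi>) * s"
  have b: "b l = of_real ?\<kappa> * (?\<beta> ^ l / fact l * of_real (half_moment (lam + l)))" for l
  proof -
    have "2 powr ((real (lam + l) + 1) / 2) = 2 powr ((real lam + 1) / 2) * sqrt 2 ^ l"
      by (simp add: powr_half_sqrt[symmetric] powr_power powr_add[symmetric] add_divide_distrib add_ac)
    then have "fact (lam + l) * rGamma (real (lam + l) / 2 + 1) =
        half_moment (lam + l) * (2 powr ((real lam + 1) / 2) * sqrt 2 ^ l) / sqrt pi"
      using half_moment_eq_rGamma[of "lam + l"] by simp
    then have "kernel_coeff lam l * rGamma (real (lam + l) / 2 + 1) = ?\<kappa> * (sqrt 2 ^ l / fact l * half_moment (lam + l))"
      by (simp add: kernel_coeff_def mult_ac)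
    then have "b l = of_real (?\<kappa> * (sqrt 2 ^ l / fact l * half_moment (lam + l))) * (of_real (2 * \<xi>) * s) ^ l"
      unfolding b_def by (simp only:)
    then show ?thesis by (simp add: power_mult_distrib mult_ac)
  qed
  show "b sums (of_real ?\<kappa> * half_laplace lam ?\<beta>)"
    unfolding b by (intro sums_mult half_laplace_sums)
  show "summable (\<lambda>l. norm (b l))"
    unfolding b norm_mult[of "of_real ?\<kappa>"] by (intro summable_mult summable_norm_half_laplace)
qed

text \<open>
  By \<open>kernel_term_antidiagonal\<close> the terms are absolutely summable over the pairs \<open>(l, p)\<close> with their finite
  fibres; the bijection \<open>k = l + 2 * i\<close>, \<open>p = i + 2 * j\<close> transports the sum to the index set \<open>((k, j), i)\<close>
  in which the kernel is given.
\<close>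

lemma kernel_term_has_sum:
  "((\<lambda>(q, i). kernel_term lam \<xi> s (fst q - 2 * i) i (snd q)) has_sum
     (of_real (2 powr ((real lam + 1) / 2) / (sqrt pi * fact lam)) *
      half_laplace lam (of_real (2 * sqrt 2 * \<xi>) * s) * exp (- 2 * s\<^sup>2)))
     (SIGMA q:UNIV \<times> UNIV. {..fst q div 2})"
proof -
  define b where "b = (\<lambda>l. of_real (kernel_coeff lam l * rGamma (real (lam + l) / 2 + 1)) * (of_real (2 * \<xi>) * s) ^ l)"
  define d where "d = (\<lambda>p. (- 2 * s\<^sup>2) ^ p / fact p :: complex)"
  let ?H = "of_real (2 powr ((real lam + 1) / 2) / (sqrt pi * fact lam)) *
      half_laplace lam (of_real (2 * sqrt 2 * \<xi>) * s)"
  let ?S = "SIGMA q:UNIV \<times> UNIV. {..snd q div 2 :: nat}"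
  define f where "f = (\<lambda>(q, j). kernel_term lam \<xi> s (fst q) (snd q - 2 * j) j)"
  have b: "b sums ?H" "summable (\<lambda>l. norm (b l))"
    unfolding b_def by (rule kernel_coeff_sums)+
  have d: "summable (\<lambda>p. norm (d p))" "d sums exp (- 2 * s\<^sup>2)"
  proof -
    have "d = (\<lambda>p. (- 2 * s\<^sup>2) ^ p /\<^sub>R fact p)"
      by (rule ext) (simp add: d_def scaleR_conv_of_real field_simps)
    then show "summable (\<lambda>p. norm (d p))" "d sums exp (- 2 * s\<^sup>2)"
      using summable_norm_exp exp_converges by (simp_all only:)
  qed
  have bd: "((\<lambda>q. b (fst q) * d (snd q)) has_sum (?H * exp (- 2 * s\<^sup>2))) (UNIV \<times> UNIV)"
    and nbd: "(\<lambda>q. norm (b (fst q)) * norm (d (snd q))) summable_on (UNIV \<times> UNIV)"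
  proof -
    have b': "(b has_sum ?H) UNIV" and d': "(d has_sum exp (- 2 * s\<^sup>2)) UNIV"
      using norm_summable_imp_has_sum[OF b(2) b(1)] norm_summable_imp_has_sum[OF d] .
    have nb: "(\<lambda>l. norm (b l)) summable_on UNIV" and nd: "(\<lambda>p. norm (d p)) summable_on UNIV"
      using b d by (simp_all add: summable_on_UNIV_nonneg_real_iff)
    show nbd: "(\<lambda>q. norm (b (fst q)) * norm (d (snd q))) summable_on (UNIV \<times> UNIV)"
    proof (rule summable_on_SigmaI)
      show "((\<lambda>p. norm (b (fst (l, p))) * norm (d (snd (l, p)))) has_sum
          (norm (b l) * infsum (\<lambda>p. norm (d p)) UNIV)) UNIV" for l
        using has_sum_cmult_right[OF has_sum_infsum[OF nd]] by simp
      show "(\<lambda>l. norm (b l) * infsum (\<lambda>p. norm (d p)) UNIV) summable_on UNIV"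
        by (rule summable_on_cmult_left[OF nb])
    qed auto
    have "(\<lambda>q. b (fst q) * d (snd q)) summable_on (UNIV \<times> UNIV)"
      by (rule abs_summable_summable) (use nbd in \<open>simp add: norm_mult\<close>)
    then show "((\<lambda>q. b (fst q) * d (snd q)) has_sum (?H * exp (- 2 * s\<^sup>2))) (UNIV \<times> UNIV)"
      using has_sum_cmult_left[OF b', of "exp (- 2 * s\<^sup>2)"] has_sum_cmult_right[OF d']
      by (intro has_sum_SigmaI[where g = "\<lambda>l. b l * exp (- 2 * s\<^sup>2)"]) auto
  qed
  have "(f has_sum (?H * exp (- 2 * s\<^sup>2))) ?S"
  proof (rule has_sum_SigmaI[OF _ bd])
    show "((\<lambda>j. f (q, j)) has_sum (b (fst q) * d (snd q))) {..snd q div 2}" for q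
      unfolding f_def b_def d_def kernel_term_antidiagonal(1)[symmetric]
      by (intro has_sum_finiteI) auto
    have "(\<lambda>x. norm (f x)) summable_on ?S"
    proof (rule summable_on_SigmaI[OF _ nbd])
      show "((\<lambda>j. norm (f (q, j))) has_sum (norm (b (fst q)) * norm (d (snd q)))) {..snd q div 2}" for q
        unfolding f_def b_def d_def norm_mult[symmetric] kernel_term_antidiagonal(2)[symmetric]
        by (intro has_sum_finiteI) auto
    qed auto
    then show "f summable_on ?S" by (rule abs_summable_summable)
  qed
  then show ?thesis
  proof (subst has_sum_reindex_bij_witness[where
        i = "\<lambda>((l, p), j). ((l + 2 * (p - 2 * j), j), p - 2 * j)" and
        j = "\<lambda>((k, j), i). ((k - 2 * i, i + 2 * j), j)" and T = ?S and h = f])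
  qed (auto simp: f_def)
qed

text \<open>
  The entire factor of the Bessel function, in terms of half its argument.
\<close>

definition bessel_sum :: "real \<Rightarrow> real \<Rightarrow> real" where
  "bessel_sum \<nu> y = (\<Sum>j. (- 1) ^ j / fact j * rGamma (\<nu> + real j + 1) * y ^ (2 * j))"

lemma summable_bessel_sum:
  assumes "\<nu> \<ge> 0"
  shows "summable (\<lambda>j. norm ((- 1) ^ j / fact j * rGamma (\<nu> + real j + 1) * y ^ (2 * j)))"
proof (rule summable_comparison_test')
  show "summable (\<lambda>j. rGamma (\<nu> + 1) * ((y\<^sup>2) ^ j /\<^sub>R fact j))"
    by (intro summable_mult summable_exp_generic)
  fix j :: nat
  have "rGamma (\<nu> + real j + 1) \<ge> 0"
    using Gamma_real_pos[of "\<nu> + real j + 1"] assms by (simp add: rGamma_inverse_Gamma)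
  moreover have "rGamma (\<nu> + real j + 1) \<le> rGamma (\<nu> + 1)"
  proof -
    have "pochhammer (\<nu> + 1) j \<ge> 1"
    proof (induction j)
      case (Suc j)
      then show ?case
        using mult_mono[of 1 "pochhammer (\<nu> + 1) j" 1 "\<nu> + 1 + real j"] assms by (simp add: pochhammer_Suc)
    qed simp
    then show ?thesis using pochhammer_rGamma[of "\<nu> + 1" j] \<open>rGamma (\<nu> + real j + 1) \<ge> 0\<close>
      mult_right_mono[of 1 "pochhammer (\<nu> + 1) j" "rGamma (\<nu> + real j + 1)"] by (simp add: add_ac)
  qed
  ultimately show "norm (norm ((- 1) ^ j / fact j * rGamma (\<nu> + real j + 1) * y ^ (2 * j))) \<le>
      rGamma (\<nu> + 1) * ((y\<^sup>2) ^ j /\<^sub>R fact j)"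
    by (simp add: abs_mult power_mult power_abs divide_simps mult_right_mono)
qed

lemma bessel_J_eq_bessel_sum: "bessel_J \<nu> x = (x / 2) powr \<nu> * bessel_sum \<nu> (x / 2)"
  by (simp add: bessel_J_def bessel_sum_def)

text \<open>
  The choice \<open>s = exp (- \<i> * pi / 4) * z / 2\<close> turns \<open>s ^ (4 * j)\<close> into \<open>(- 1) ^ j * (z\<^sup>2 / 4) ^ (2 * j)\<close>, the
  power in the Bessel series, and \<open>- 2 * s\<^sup>2\<close> into \<open>\<i> * z\<^sup>2 / 2\<close>.
\<close>

lemma kernel_series_sums:
  fixes z \<xi> :: real and lam :: nat
  shows "(\<lambda>k. exp (- \<i> * of_real (pi * real k / 4)) *
       of_real ((z / 2) ^ k * bessel_sum (real (k + lam) / 2) (z\<^sup>2 / 4) * normalized_gegenbauer lam k \<xi>)) sums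
     (of_real (2 powr ((real lam + 1) / 2) / (sqrt pi * fact lam)) *
      half_laplace lam ((1 - \<i>) * of_real (z * \<xi>)) * exp (\<i> / 2 * of_real (z\<^sup>2)))"
proof -
  define w where "w = exp (- \<i> * of_real (pi / 4))"
  define s where "s = w * of_real (z / 2)"
  have w: "of_real (sqrt 2) * w = 1 - \<i>"
  proof -
    have "w = cis (- (pi / 4))" by (simp add: w_def cis_conv_exp)
    then have w: "w = Complex (sqrt 2 / 2) (- (sqrt 2 / 2))" by (simp add: complex_eq_iff cos_45 sin_45)
    show ?thesis unfolding w by (simp add: complex_eq_iff)
  qed
  have w2: "w\<^sup>2 = - \<i>"
  proof -
    have "2 * w\<^sup>2 = (of_real (sqrt 2) * w)\<^sup>2"
      by (simp add: power_mult_distrib of_real_power[symmetric] del: of_real_power)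
    also have "\<dots> = 2 * (- \<i>)" unfolding w by (simp add: power2_eq_square algebra_simps)
    finally show ?thesis by simp
  qed
  have w4: "w ^ 4 = - 1" using w2 by (metis mult_2 numeral_Bit0 power_add i_squared power2_eq_square minus_mult_minus)
  have wk: "exp (- \<i> * of_real (pi * real k / 4)) = w ^ k" for k
    unfolding w_def exp_of_nat_mult[symmetric] by (simp add: mult_ac)
  have s1: "of_real (2 * sqrt 2 * \<xi>) * s = (1 - \<i>) * of_real (z * \<xi>)"
    unfolding w[symmetric] s_def by simp
  have s2: "- 2 * s\<^sup>2 = \<i> / 2 * of_real (z\<^sup>2)"
    unfolding s_def power_mult_distrib w2 by (simp add: power2_eq_square)
  have s4: "s ^ (4 * j) = of_real ((- 1) ^ j * (z\<^sup>2 / 4) ^ (2 * j))" for j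
  proof -
    have "s ^ 4 = of_real (- ((z\<^sup>2 / 4)\<^sup>2))"
      unfolding s_def power_mult_distrib w4 by (simp add: power_divide eval_nat_numeral)
    then have "(s ^ 4) ^ j = of_real ((- ((z\<^sup>2 / 4)\<^sup>2)) ^ j)" by simp
    then show ?thesis by (simp only: power_mult power_minus[of "(z\<^sup>2 / 4)\<^sup>2"])
  qed
  let ?T = "of_real (2 powr ((real lam + 1) / 2) / (sqrt pi * fact lam)) *
      half_laplace lam ((1 - \<i>) * of_real (z * \<xi>)) * exp (\<i> / 2 * of_real (z\<^sup>2))"
  define C where "C = (\<lambda>k j. of_real (rGamma (real (k + lam) / 2 + 1 + real j) / fact j) * s ^ (k + 4 * j) *
     of_real (normalized_gegenbauer lam k \<xi>))"
  have "((\<lambda>q. C (fst q) (snd q)) has_sum ?T) (UNIV \<times> UNIV)"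
  proof (rule has_sum_SigmaD[OF kernel_term_has_sum[of lam \<xi> s, unfolded s1 s2]])
    show "((\<lambda>i. case (q, i) of (q, i) \<Rightarrow> kernel_term lam \<xi> s (fst q - 2 * i) i (snd q)) has_sum
       C (fst q) (snd q)) {..fst q div 2}" for q
      unfolding C_def kernel_term_row[symmetric] by (intro has_sum_finiteI) auto
  qed
  then have "((\<lambda>k. w ^ k * of_real ((z / 2) ^ k * bessel_sum (real (k + lam) / 2) (z\<^sup>2 / 4) * normalized_gegenbauer lam k \<xi>)) has_sum ?T) UNIV"
  proof (rule has_sum_SigmaD)
    fix k :: nat
    let ?a = "\<lambda>j. (- 1) ^ j / fact j * rGamma (real (k + lam) / 2 + real j + 1) * (z\<^sup>2 / 4) ^ (2 * j)"
    have "(?a has_sum bessel_sum (real (k + lam) / 2) (z\<^sup>2 / 4)) UNIV"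
      unfolding bessel_sum_def
      by (intro norm_summable_imp_has_sum summable_sums summable_norm_cancel[OF summable_bessel_sum] summable_bessel_sum) auto
    then have "((\<lambda>j. complex_of_real (?a j)) has_sum of_real (bessel_sum (real (k + lam) / 2) (z\<^sup>2 / 4))) UNIV"
      by (rule has_sum_of_real)
    then have "((\<lambda>j. s ^ k * of_real (normalized_gegenbauer lam k \<xi>) * complex_of_real (?a j)) has_sum
       s ^ k * of_real (normalized_gegenbauer lam k \<xi>) * of_real (bessel_sum (real (k + lam) / 2) (z\<^sup>2 / 4))) UNIV"
      by (rule has_sum_cmult_right)
    also have "(\<lambda>j. s ^ k * of_real (normalized_gegenbauer lam k \<xi>) * complex_of_real (?a j)) = (\<lambda>j. C k j)"
      unfolding C_def power_add s4 by (rule ext) (simp add: add_ac mult_ac)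
    also have "s ^ k * of_real (normalized_gegenbauer lam k \<xi>) * of_real (bessel_sum (real (k + lam) / 2) (z\<^sup>2 / 4)) =
      w ^ k * of_real ((z / 2) ^ k * bessel_sum (real (k + lam) / 2) (z\<^sup>2 / 4) * normalized_gegenbauer lam k \<xi>)"
      unfolding s_def power_mult_distrib by simp
    finally show "((\<lambda>j. C (fst (k, j)) (snd (k, j))) has_sum
      w ^ k * of_real ((z / 2) ^ k * bessel_sum (real (k + lam) / 2) (z\<^sup>2 / 4) * normalized_gegenbauer lam k \<xi>)) UNIV"
      by simp
  qed
  then show ?thesis unfolding wk by (rule has_sum_imp_sums)
qed

section \<open>Closed form and growth of the kernel\<close>

lemma radial_kernel_closed_form:
  assumes z: "z > 0" and \<xi>: "\<bar>\<xi>\<bar> \<le> 1"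
  shows "radial_kernel (2 * Suc lam) 4 z \<xi> =
    of_real (2 powr ((real lam + 1) / 2) * Gamma (real lam / 2 + 1) / (sqrt pi * fact lam)) *
    exp (\<i> / 2 * of_real (z\<^sup>2)) * half_laplace lam ((1 - \<i>) * of_real (z * \<xi>))"
proof -
  define g where "g = (\<lambda>k. exp (- \<i> * of_real (pi * real k / 4)) *
       of_real ((z / 2) ^ k * bessel_sum (real (k + lam) / 2) (z\<^sup>2 / 4) * normalized_gegenbauer lam k \<xi>))"
  let ?T = "of_real (2 powr ((real lam + 1) / 2) / (sqrt pi * fact lam)) *
      half_laplace lam ((1 - \<i>) * of_real (z * \<xi>)) * exp (\<i> / 2 * of_real (z\<^sup>2))"
  have g: "g sums ?T" unfolding g_def by (rule kernel_series_sums)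
  have za: "2 / 4 * z powr (4 / 2) / 2 = z\<^sup>2 / 4" using z by (simp add: powr_numeral)
  have J: "bessel_J (real k / 2) (2 / 4 * z powr (4 / 2)) = (z / 2) ^ k * bessel_sum (real k / 2) (z\<^sup>2 / 4)" for k
  proof -
    have "(z\<^sup>2 / 4) powr (real k / 2) = ((z / 2) powr 2) powr (real k / 2)"
      using z by (simp add: power_divide)
    also have "\<dots> = (z / 2) powr real k" unfolding powr_powr by simp
    also have "\<dots> = (z / 2) ^ k" using z by (simp add: powr_realpow)
    finally show ?thesis unfolding bessel_J_eq_bessel_sum za by simp
  qed
  have "radial_kernel (2 * Suc lam) 4 z \<xi> = of_real (Gamma (real lam / 2 + 1)) * ?T"
  proof (cases "lam = 0")
    case True
    have \<xi>': "cos (arccos \<xi>) = \<xi>" using \<xi> by (intro cos_arccos) auto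
    have "g 0 = of_real (bessel_J 0 (2 / 4 * z powr (4 / 2)))"
      using J[of 0] True by (simp add: g_def normalized_gegenbauer_0_0)
    moreover have "g (Suc j) = 2 * (exp (- \<i> * of_real (pi * real (Suc j) / 4)) *
              of_real (bessel_J (2 * real (Suc j) / 4) (2 / 4 * z powr (4 / 2)) * cos (real (Suc j) * arccos \<xi>)))" for j
    proof -
      have e: "2 * real (Suc j) / 4 = real (Suc j) / 2" by simp
      have "normalized_gegenbauer 0 (Suc j) \<xi> = 2 * cos (real (Suc j) * arccos \<xi>)"
        using normalized_gegenbauer_0_cos[of "Suc j" "arccos \<xi>"] unfolding \<xi>' by simp
      then show ?thesis unfolding e J g_def True by simp
    qed
    moreover have "?T = g 0 + (\<Sum>j. g (Suc j))"
      using g suminf_split_head[of g] by (simp add: sums_iff)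
    moreover have "summable (\<lambda>j. g (Suc j))" using g by (simp add: sums_iff summable_Suc_iff)
    ultimately show ?thesis
      unfolding radial_kernel_def Let_def using True
      by (subst suminf_mult[symmetric]) (simp_all add: Let_def summable_cmult_iff)
  next
    case False
    then have lam: "lam \<ge> 1" by simp
    have t: "exp (- \<i> * of_real (pi * real k / 4)) *
          of_real ((real lam + real k) / real lam * z powr (- real lam) *
            bessel_J (2 * (real k + real lam) / 4) (2 / 4 * z powr (4 / 2)) * gegenbauer k (real lam) \<xi>)
        = of_real (2 powr (- real lam)) * g k" for k
    proof -
      have e: "2 * (real k + real lam) / 4 = real (k + lam) / 2" by simp
      have reorder: "a * p * (r * b) * c = q * (t * b * (a * c))" if "p * r = q * t" for a b c p q r t :: real
        using arg_cong[OF that, of "\<lambda>v. v * (a * b * c)"] by (simp add: mult_ac)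
      have "z powr (- real lam) * (z / 2) ^ (k + lam) = 2 powr (- real lam) * (z / 2) ^ k"
        using z by (simp add: powr_minus powr_realpow power_add power_divide field_simps)
      then have "(real lam + real k) / real lam * z powr (- real lam) *
            ((z / 2) ^ (k + lam) * bessel_sum (real (k + lam) / 2) (z\<^sup>2 / 4)) * gegenbauer k (real lam) \<xi> =
          2 powr (- real lam) * ((z / 2) ^ k * bessel_sum (real (k + lam) / 2) (z\<^sup>2 / 4) *
            ((real lam + real k) / real lam * gegenbauer k (real lam) \<xi>))"
        by (rule reorder)
      then show ?thesis
        unfolding e J g_def normalized_gegenbauer_eq[OF lam] by (simp only: of_real_mult mult_ac)
    qed
    have "(4::real) powr (2 * real lam / 4) = 2 powr real lam"
    proof -
      have "(4::real) = 2 powr 2" by (simp add: powr_numeral)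
      then show ?thesis by (simp add: powr_powr)
    qed
    moreover have "(2 * real lam + 4) / 4 = real lam / 2 + 1" by (simp add: field_simps)
    moreover have "(\<Sum>k. of_real (2 powr (- real lam)) * g k) = of_real (2 powr (- real lam)) * ?T"
      using sums_mult[OF g] by (simp add: sums_iff)
    moreover have "complex_of_real (2 powr real lam) * of_real (2 powr (- real lam)) = 1"
      by (simp add: of_real_mult[symmetric] powr_add[symmetric] del: of_real_mult)
    moreover have "(real (2 * Suc lam) - 2) / 2 = real lam" by simp
    moreover have "2 * Suc lam \<noteq> 2" using False by simp
    ultimately show ?thesis
      unfolding radial_kernel_def Let_def by (simp only: if_False t) (simp add: mult_ac)
  qed
  then show ?thesis by (simp add: mult_ac)
qed

text \<open>
  For \<open>x = 0\<close> or \<open>y = 0\<close> the right-hand side is the constant times \<open>half_moment lam\<close>, and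
  \<open>half_moment_eq_rGamma\<close> says that this product is \<open>1\<close>.
\<close>

lemma deformed_kernel_closed_form:
  fixes x y :: "real ^ 'm::finite"
  assumes dim: "CARD('m) = 2 * Suc lam"
  shows "deformed_kernel 4 x y =
    of_real (2 powr ((real lam + 1) / 2) * Gamma (real lam / 2 + 1) / (sqrt pi * fact lam)) *
    exp (\<i> / 2 * of_real ((norm x * norm y)\<^sup>2)) * half_laplace lam ((1 - \<i>) * of_real (x \<bullet> y))"
proof (cases "x = 0 \<or> y = 0")
  case True
  have "half_laplace lam 0 = of_real (half_moment lam)"
    unfolding half_laplace_def by (subst suminf_finite[of "{0}"]) auto
  moreover have "2 powr ((real lam + 1) / 2) * Gamma (real lam / 2 + 1) / (sqrt pi * fact lam) * half_moment lam = 1"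
  proof -
    have G: "Gamma (real lam / 2 + 1) > 0" by (rule Gamma_real_pos) simp
    have normalize: "p * G / (q * F) * M = 1"
      if "M * p / q = F * inverse G" "G > 0" "q > 0" "F > 0" for p q F G M :: real
      using that by (simp add: field_simps)
    show ?thesis
      by (rule normalize[OF half_moment_eq_rGamma[of lam, unfolded rGamma_inverse_Gamma] G]) simp_all
  qed
  ultimately show ?thesis using True
    by (auto simp: deformed_kernel_def simp flip: of_real_mult)
next
  case False
  define z where "z = norm x * norm y"
  have z: "z > 0" using False by (simp add: z_def)
  have "\<bar>x \<bullet> y\<bar> \<le> z" unfolding z_def by (rule Cauchy_Schwarz_ineq2)
  then have "\<bar>(x \<bullet> y) / z\<bar> \<le> 1" using z by simp
  from radial_kernel_closed_form[OF z this, of lam] show ?thesis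
    using False z by (simp add: deformed_kernel_def dim z_def)
qed

lemma norm_deformed_kernel:
  fixes x y :: "real ^ 'm::finite"
  assumes dim: "CARD('m) = 2 * Suc lam"
  shows "norm (deformed_kernel 4 x y) =
    2 powr ((real lam + 1) / 2) * Gamma (real lam / 2 + 1) / (sqrt pi * fact lam) *
    norm (half_laplace lam ((1 - \<i>) * of_real (x \<bullet> y)))"
proof -
  have "norm (exp (\<i> / 2 * of_real ((norm x * norm y)\<^sup>2))) = 1"
    using norm_exp_i_times[of "(norm x * norm y)\<^sup>2 / 2"] by simp
  moreover have "Gamma (real lam / 2 + 1) > 0" by (rule Gamma_real_pos) simp
  ultimately show ?thesis
    unfolding deformed_kernel_closed_form[OF dim] norm_mult norm_of_real by simp
qed

theorem theorem2p5:
  fixes n :: nat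
  assumes n: "n \<ge> 1"
    and dim: "CARD('m::finite) = 2 * n"
  shows
    "(\<forall>(x :: real ^ 'm) (y :: real ^ 'm) \<theta>.
        \<theta> \<in> {0..pi} \<and> x \<bullet> y = norm x * norm y * cos \<theta> \<longrightarrow>
        (let z = norm x * norm y;
             c\<^sub>n = 2 powr (real n / 2) * Gamma ((real n + 1) / 2) / sqrt pi
         in deformed_kernel 4 x y =
              of_real c\<^sub>n * exp (\<i> / 2 * of_real (z\<^sup>2 * (sin \<theta>)\<^sup>2)) *
              parabolic_D_neg n ((\<i> - 1) * of_real (z * cos \<theta>))))
     \<and>
     (\<exists>C>0. \<forall>(x :: real ^ 'm) (y :: real ^ 'm).
        cmod (deformed_kernel 4 x y)
          \<le> C * (1 + norm x * norm y) powr ((real CARD('m) - 2) / 2))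
     \<and>
     (\<forall>s < (real CARD('m) - 2) / 2.
        \<not> (\<exists>C>0. \<forall>(x :: real ^ 'm) (y :: real ^ 'm).
              cmod (deformed_kernel 4 x y) \<le> C * (1 + norm x * norm y) powr s))"
proof -
  obtain lam where n_eq: "n = Suc lam" using n by (cases n) auto
  have dim': "CARD('m) = 2 * Suc lam" by (simp add: dim n_eq)
  have order: "(real CARD('m) - 2) / 2 = real lam" by (simp add: dim')
  define K where "K = 2 powr ((real lam + 1) / 2) * Gamma (real lam / 2 + 1) / (sqrt pi * fact lam)"
  have K: "K > 0" unfolding K_def by (intro divide_pos_pos mult_pos_pos Gamma_real_pos) auto
  note nK = norm_deformed_kernel[OF dim', folded K_def]

  have formula: "deformed_kernel 4 x y =
      of_real (2 powr (real n / 2) * Gamma ((real n + 1) / 2) / sqrt pi) *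
      exp (\<i> / 2 * of_real ((norm x * norm y)\<^sup>2 * (sin \<theta>)\<^sup>2)) *
      parabolic_D_neg n ((\<i> - 1) * of_real (norm x * norm y * cos \<theta>))"
    if "x \<bullet> y = norm x * norm y * cos \<theta>" for x y :: "real ^ 'm" and \<theta>
  proof -
    define z where "z = norm x * norm y"
    define w where "w = (\<i> - 1) * complex_of_real (z * cos \<theta>)"
    have w: "- w = (1 - \<i>) * of_real (x \<bullet> y)" unfolding that w_def z_def by (simp add: algebra_simps)
    have "- (w\<^sup>2) / 4 = \<i> / 2 * of_real (z\<^sup>2 * (cos \<theta>)\<^sup>2)"
      by (simp add: w_def power2_eq_square algebra_simps)
    moreover have "z\<^sup>2 * (sin \<theta>)\<^sup>2 + z\<^sup>2 * (cos \<theta>)\<^sup>2 = z\<^sup>2"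
      by (simp flip: distrib_left)
    ultimately have "\<i> / 2 * of_real (z\<^sup>2 * (sin \<theta>)\<^sup>2) + - (w\<^sup>2) / 4 = \<i> / 2 * of_real (z\<^sup>2)"
      by (simp only: of_real_add[symmetric] distrib_left[symmetric])
    then have e: "exp (\<i> / 2 * of_real (z\<^sup>2 * (sin \<theta>)\<^sup>2)) * exp (- (w\<^sup>2) / 4) = exp (\<i> / 2 * of_real (z\<^sup>2))"
      unfolding exp_add[symmetric] by (rule arg_cong)
    have c: "(real n + 1) / 2 = real lam / 2 + 1" "real n / 2 = (real lam + 1) / 2"
      by (simp_all add: n_eq field_simps)
    show ?thesis
      unfolding deformed_kernel_closed_form[OF dim'] n_eq parabolic_D_neg_eq_half_laplace
        z_def[symmetric] w_def[symmetric] w c[unfolded n_eq] e[symmetric]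
      by simp
  qed

  obtain C where C: "C > 0" "\<And>u. norm (half_laplace lam ((1 - \<i>) * of_real u)) \<le> C * (1 + \<bar>u\<bar>) ^ lam"
    using half_laplace_growth by blast
  have upper: "cmod (deformed_kernel 4 x y) \<le> K * C * (1 + norm x * norm y) powr real lam"
    for x y :: "real ^ 'm"
  proof -
    have "(1 + \<bar>x \<bullet> y\<bar>) ^ lam \<le> (1 + norm x * norm y) ^ lam"
      by (intro power_mono add_left_mono Cauchy_Schwarz_ineq2) auto
    then have "norm (half_laplace lam ((1 - \<i>) * of_real (x \<bullet> y))) \<le> C * (1 + norm x * norm y) ^ lam"
      using C(2)[of "x \<bullet> y"] mult_left_mono[of _ _ C] C(1) by (meson less_imp_le order_trans)
    then show ?thesis
      unfolding nK using K by (simp add: powr_realpow add_pos_nonneg mult.assoc)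
  qed

  have sharp: False
    if s: "s < real lam" and D: "\<And>x y :: real ^ 'm. cmod (deformed_kernel 4 x y) \<le> D * (1 + norm x * norm y) powr s" for s D
  proof -
    \<comment> \<open>The growth is attained in the direction \<open>\<theta> = 0\<close>: take \<open>x = u *\<^sub>R e\<close> and \<open>y = e\<close>, so that the inner product is \<open>u\<close>.\<close>
    define e :: "real ^ 'm" where "e = axis undefined 1"
    have e: "norm e = 1" by (simp add: e_def)
    define r where "r = (\<lambda>u. norm (half_laplace lam ((1 - \<i>) * of_real u)) / u ^ lam)"
    have "eventually (\<lambda>u. r u \<le> D / K * ((1 + u) powr s / u ^ lam)) at_top"
      using eventually_gt_at_top[of 0]
    proof eventually_elim
      case (elim u)
      have "K * norm (half_laplace lam ((1 - \<i>) * of_real u)) \<le> D * (1 + u) powr s"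
        using D[of "u *\<^sub>R e" e] elim unfolding nK by (simp add: e dot_square_norm)
      then have "norm (half_laplace lam ((1 - \<i>) * of_real u)) \<le> D * (1 + u) powr s / K"
        using K by (simp add: pos_le_divide_eq mult.commute)
      then have "r u \<le> D * (1 + u) powr s / K / u ^ lam"
        unfolding r_def using elim by (intro divide_right_mono) auto
      then show ?case by (simp add: mult_ac)
    qed
    moreover have "((\<lambda>u. D / K * ((1 + u) powr s / u ^ lam)) \<longlongrightarrow> D / K * 0) at_top"
    proof (intro tendsto_mult tendsto_const)
      have "((\<lambda>u::real. (1 + u) powr s / u powr real lam) \<longlongrightarrow> 0) at_top"
        using s by real_asymp
      moreover have "eventually (\<lambda>u::real. (1 + u) powr s / u powr real lam = (1 + u) powr s / u ^ lam) at_top"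
        using eventually_gt_at_top[of 0] by eventually_elim (simp add: powr_realpow)
      ultimately show "((\<lambda>u::real. (1 + u) powr s / u ^ lam) \<longlongrightarrow> 0) at_top"
        by (simp add: tendsto_cong)
    qed
    ultimately have "sqrt 2 ^ lam * sqrt (2 * pi) \<le> D / K * 0"
      using half_laplace_asymptotic[of lam, folded r_def] by (intro tendsto_le[OF trivial_limit_at_top_linorder])
    moreover have "sqrt 2 ^ lam * sqrt (2 * pi) > 0" by simp
    ultimately show False by simp
  qed

  show ?thesis
  proof (intro conjI)
    show "\<forall>(x :: real ^ 'm) (y :: real ^ 'm) \<theta>.
        \<theta> \<in> {0..pi} \<and> x \<bullet> y = norm x * norm y * cos \<theta> \<longrightarrow>
        (let z = norm x * norm y;
             c\<^sub>n = 2 powr (real n / 2) * Gamma ((real n + 1) / 2) / sqrt pi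
         in deformed_kernel 4 x y =
              of_real c\<^sub>n * exp (\<i> / 2 * of_real (z\<^sup>2 * (sin \<theta>)\<^sup>2)) *
              parabolic_D_neg n ((\<i> - 1) * of_real (z * cos \<theta>)))"
      unfolding Let_def using formula by blast
    show "\<exists>C>0. \<forall>(x :: real ^ 'm) (y :: real ^ 'm).
        cmod (deformed_kernel 4 x y) \<le> C * (1 + norm x * norm y) powr ((real CARD('m) - 2) / 2)"
      unfolding order using upper K C(1) by (intro exI[of _ "K * C"]) auto
    show "\<forall>s < (real CARD('m) - 2) / 2.
        \<not> (\<exists>C>0. \<forall>(x :: real ^ 'm) (y :: real ^ 'm).
              cmod (deformed_kernel 4 x y) \<le> C * (1 + norm x * norm y) powr s)"
      unfolding order using sharp by blast
  qed
qed

end
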